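(* Let $H$ be a finitely generated hyperbolic group and let $\varphi\in\mathrm{End}(H)$ be an endomorphism admitting a continuous extension $\hat\varphi:\widehat H\to\widehat H$ to the completion $\widehat H$ of $H$. Then the subgroup $\mathrm{Fix}(\varphi)=\{h\in H : h\varphi=h\}$ is finitely generated.
   Context: Maps are written on the right. $H$ is generated by a finite set $A$, $d_A$ is the word metric, and $H$ is hyperbolic if its Cayley graph with respect to $A$ has $\delta$-slim geodesic triangles for some $\delta\ge0$. For $g,h,p\in H$, $(g|h)_p^A=\frac12(d_A(p,g)+d_A(p,h)-d_A(g,h))$. Put $\rho^A_{p,\gamma}(g,h)=e^{-\gamma(g|h)_p^A}$ if $g\ne h$ and $0$ if $g=h$. A visual metric on $H$ is a metric $d$ on $H$ such that, for some $p\in H$, $\gamma>0$, $T\ge1$, $\frac1T\rho^A_{p,\gamma}(g,h)\le d(g,h)\le T\rho^A_{p,\gamma}(g,h)$ for all $g,h\in H$. The completion $\widehat H$ of $H$ is the metric completion of $(H,d)$ for a visual metric $d$; all visual metrics give equivalent completions, $\widehat H$ is compact, and $\widehat H=H\cup\partial H$ where $\partial H$ is the Gromov boundary with its Gromov topology. *)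

theory Defs
  imports "HOL-Algebra.Generated_Groups" "HOL-Analysis.Analysis"
begin

definition word_length :: "('a, 'm) monoid_scheme \<Rightarrow> 'a set \<Rightarrow> 'a \<Rightarrow> nat" where
  "word_length G A g =
     (LEAST n. \<exists>w. length w = n \<and> set w \<subseteq> A \<union> m_inv G ` A
                   \<and> foldr (\<lambda>a b. a \<otimes>\<^bsub>G\<^esub> b) w \<one>\<^bsub>G\<^esub> = g)"

definition word_metric :: "('a, 'm) monoid_scheme \<Rightarrow> 'a set \<Rightarrow> 'a \<Rightarrow> 'a \<Rightarrow> real" where
  "word_metric G A g h = real (word_length G A (inv\<^bsub>G\<^esub> g \<otimes>\<^bsub>G\<^esub> h))"

text \<open>The geometric realization: besides the vertices \<open>g\<close>, each edge from \<open>g\<close> to \<open>g \<otimes> a\<close>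
  contributes the points \<open>Inner g a t\<close> of an open unit segment, \<open>t\<close> being the distance
  to \<open>g\<close> along the edge.\<close>

datatype 'a cayley_point = Vertex 'a | Inner 'a 'a real

definition cayley_graph :: "('a, 'm) monoid_scheme \<Rightarrow> 'a set \<Rightarrow> 'a cayley_point set" where
  "cayley_graph G A =
     Vertex ` carrier G \<union> {Inner g a t |g a t. g \<in> carrier G \<and> a \<in> A \<and> 0 < t \<and> t < 1}"

text \<open>The vertices through which one can leave the closed edge containing a point, each with
  the distance to it along that edge.\<close>

fun exits :: "('a, 'm) monoid_scheme \<Rightarrow> 'a cayley_point \<Rightarrow> ('a \<times> real) set" where
  "exits G (Vertex g) = {(g, 0)}"
| "exits G (Inner g a t) = {(g, t), (g \<otimes>\<^bsub>G\<^esub> a, 1 - t)}"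

fun along_edge :: "'a cayley_point \<Rightarrow> 'a cayley_point \<Rightarrow> real set" where
  "along_edge (Inner g a s) (Inner h b t) = (if g = h \<and> a = b then {\<bar>s - t\<bar>} else {})"
| "along_edge _ _ = {}"

text \<open>The path metric: a shortest path either stays inside one edge or runs through vertices.\<close>

definition cayley_dist ::
  "('a, 'm) monoid_scheme \<Rightarrow> 'a set \<Rightarrow> 'a cayley_point \<Rightarrow> 'a cayley_point \<Rightarrow> real" where
  "cayley_dist G A p q =
     Min (along_edge p q \<union>
          (\<lambda>((x, r), (y, s)). r + word_metric G A x y + s) ` (exits G p \<times> exits G q))"

definition geodesic_segment ::
  "'p set \<Rightarrow> ('p \<Rightarrow> 'p \<Rightarrow> real) \<Rightarrow> 'p \<Rightarrow> 'p \<Rightarrow> 'p set \<Rightarrow> bool" where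
  "geodesic_segment M d x y S \<longleftrightarrow>
     (\<exists>l \<xi>. 0 \<le> l \<and> \<xi> 0 = x \<and> \<xi> l = y \<and> S = \<xi> ` {0..l} \<and> S \<subseteq> M
            \<and> (\<forall>u\<in>{0..l}. \<forall>v\<in>{0..l}. d (\<xi> u) (\<xi> v) = \<bar>u - v\<bar>))"

text \<open>It suffices to mention one side, since the three sides may be permuted cyclically.\<close>

definition slim_triangles :: "'p set \<Rightarrow> ('p \<Rightarrow> 'p \<Rightarrow> real) \<Rightarrow> real \<Rightarrow> bool" where
  "slim_triangles M d \<delta> \<longleftrightarrow>
     (\<forall>x y z S1 S2 S3.
        geodesic_segment M d x y S1 \<longrightarrow> geodesic_segment M d y z S2 \<longrightarrow>
        geodesic_segment M d z x S3 \<longrightarrow>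
        (\<forall>p\<in>S1. \<exists>q\<in>S2 \<union> S3. d p q \<le> \<delta>))"

definition hyperbolic_wrt :: "('a, 'm) monoid_scheme \<Rightarrow> 'a set \<Rightarrow> bool" where
  "hyperbolic_wrt G A \<longleftrightarrow>
     (\<exists>\<delta>\<ge>0. slim_triangles (cayley_graph G A) (cayley_dist G A) \<delta>)"

definition gromov_product ::
  "('a, 'm) monoid_scheme \<Rightarrow> 'a set \<Rightarrow> 'a \<Rightarrow> 'a \<Rightarrow> 'a \<Rightarrow> real" where
  "gromov_product G A p g h =
     (word_metric G A p g + word_metric G A p h - word_metric G A g h) / 2"

definition visual_rho ::
  "('a, 'm) monoid_scheme \<Rightarrow> 'a set \<Rightarrow> 'a \<Rightarrow> real \<Rightarrow> 'a \<Rightarrow> 'a \<Rightarrow> real" where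
  "visual_rho G A p \<gamma> g h = (if g = h then 0 else exp (- \<gamma> * gromov_product G A p g h))"

definition visual_metric ::
  "('a, 'm) monoid_scheme \<Rightarrow> 'a set \<Rightarrow> ('a \<Rightarrow> 'a \<Rightarrow> real) \<Rightarrow> bool" where
  "visual_metric G A d \<longleftrightarrow>
     Metric_space (carrier G) d \<and>
     (\<exists>p\<in>carrier G. \<exists>\<gamma>>0. \<exists>T\<ge>1. \<forall>g\<in>carrier G. \<forall>h\<in>carrier G.
        1 / T * visual_rho G A p \<gamma> g h \<le> d g h \<and> d g h \<le> T * visual_rho G A p \<gamma> g h)"

definition is_metric_completion ::
  "'a set \<Rightarrow> ('a \<Rightarrow> 'a \<Rightarrow> real) \<Rightarrow> 'b set \<Rightarrow> ('b \<Rightarrow> 'b \<Rightarrow> real) \<Rightarrow> ('a \<Rightarrow> 'b) \<Rightarrow> bool" where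
  "is_metric_completion M d M' d' \<iota> \<longleftrightarrow>
     Metric_space M d \<and> Metric_space M' d' \<and> Metric_space.mcomplete M' d' \<and>
     \<iota> \<in> M \<rightarrow> M' \<and> (\<forall>x\<in>M. \<forall>y\<in>M. d' (\<iota> x) (\<iota> y) = d x y) \<and>
     (Metric_space.mtopology M' d') closure_of (\<iota> ` M) = M'"

definition Fix :: "('a, 'm) monoid_scheme \<Rightarrow> ('a \<Rightarrow> 'a) \<Rightarrow> 'a set" where
  "Fix G \<phi> = {h \<in> carrier G. \<phi> h = h}"

definition finitely_generated_subgroup :: "('a, 'm) monoid_scheme \<Rightarrow> 'a set \<Rightarrow> bool" where
  "finitely_generated_subgroup G K \<longleftrightarrow>
     subgroup K G \<and> (\<exists>S. finite S \<and> S \<subseteq> K \<and> generate G S = K)"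

end

theory Submission
  imports Defs
begin

text \<open>
  Let \<open>K\<close> be the fixed subgroup and call \<open>k \<in> K\<close> indecomposable if it is not a product of
  shorter elements of \<open>K\<close>; we show that only finitely many such \<open>k\<close> exist. Points that \<open>\<phi>\<close> moves a
  bounded distance lie near \<open>K\<close>, so on a geodesic from \<open>1\<close> to an indecomposable \<open>k\<close> all
  points except those near the ends are moved far. Hyperbolicity then forces the geodesic to have
  one sink: points before it are moved in the direction of \<open>k\<close>, points after it in the direction of
  \<open>1\<close>. Since \<open>\<phi>\<close> is Lipschitz, two geodesics that follow the direction in which \<open>\<phi>\<close> moves their
  points and start close together stay uniformly close; this is a coarse version of the
  Goldstein--Turner flow. With infinitely many indecomposable elements, many translates of one
  flow line would merge into another one, and the properness of the word metric together
  with indecomposability excludes this.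
\<close>

section \<open>Geodesics in hyperbolic spaces\<close>

context Metric_space
begin

definition gprod :: "'a \<Rightarrow> 'a \<Rightarrow> 'a \<Rightarrow> real" where
  "gprod p x y = (d p x + d p y - d x y) / 2"

text \<open>Only integer times are parametrized: in a word metric the vertices carry all that
  matters, and induction along a geodesic becomes possible.\<close>

definition discrete_geodesic :: "(nat \<Rightarrow> 'a) \<Rightarrow> nat \<Rightarrow> bool" where
  "discrete_geodesic u m \<longleftrightarrow>
     (\<forall>i\<le>m. u i \<in> M) \<and> (\<forall>i\<le>m. \<forall>j\<le>m. d (u i) (u j) = \<bar>real i - real j\<bar>)"

text \<open>Seen from \<open>u i\<close>, the point \<open>F (u i)\<close> lies in the direction of the end \<open>u m\<close>.\<close>

definition heads :: "('a \<Rightarrow> 'a) \<Rightarrow> real \<Rightarrow> (nat \<Rightarrow> 'a) \<Rightarrow> nat \<Rightarrow> nat \<Rightarrow> bool" where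
  "heads F C u m i \<longleftrightarrow> C < gprod (u i) (F (u i)) (u m)"

lemma discrete_geodesic_in: "discrete_geodesic u m \<Longrightarrow> i \<le> m \<Longrightarrow> u i \<in> M"
  by (simp add: discrete_geodesic_def)

lemma discrete_geodesic_dist:
  "discrete_geodesic u m \<Longrightarrow> i \<le> j \<Longrightarrow> j \<le> m \<Longrightarrow> d (u i) (u j) = real j - real i"
  by (simp add: discrete_geodesic_def)

lemma discrete_geodesic_dist':
  "discrete_geodesic u m \<Longrightarrow> i \<le> j \<Longrightarrow> j \<le> m \<Longrightarrow> d (u j) (u i) = real j - real i"
  by (simp add: discrete_geodesic_def)

lemma discrete_geodesic_rev:
  "discrete_geodesic u m \<Longrightarrow> discrete_geodesic (\<lambda>i. u (m - i)) m"
  by (auto simp: discrete_geodesic_def)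

lemma gprod_commute: "gprod p x y = gprod p y x"
  by (simp add: gprod_def commute)

lemma gprod_le_dist:
  assumes "p \<in> M" "x \<in> M" "y \<in> M"
  shows "gprod p x y \<le> d p x"
  using triangle[of p x y] assms by (simp add: gprod_def)

lemma gprod_change_base:
  assumes "p \<in> M" "q \<in> M" "x \<in> M" "y \<in> M"
  shows "gprod p x y \<le> gprod q x y + d p q"
  using triangle[of p q x] triangle[of p q y] assms by (simp add: gprod_def field_simps)

text \<open>This is how the Lipschitz bound enters: if \<open>y\<close> is much closer to
  \<open>x\<close> than \<open>p\<close> is, then \<open>x\<close> and \<open>y\<close> lie in the
  same direction from \<open>p\<close>.\<close>

lemma gprod_ge_dist_diff:
  assumes "p \<in> M" "x \<in> M" "y \<in> M"
  shows "d p x - d x y \<le> gprod p x y"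
  using triangle[of p y x] assms by (simp add: gprod_def commute field_simps)

end

locale gromov_hyperbolic = Metric_space +
  fixes \<delta> :: real
  assumes delta_nonneg: "0 \<le> \<delta>"
    and four_point: "\<lbrakk>p \<in> M; x \<in> M; y \<in> M; z \<in> M\<rbrakk> \<Longrightarrow>
      min (gprod p x z) (gprod p z y) - \<delta> \<le> gprod p x y"
begin

lemma four_point_chain:
  assumes "p \<in> M" "x \<in> M" "y \<in> M" "z \<in> M" "w \<in> M"
    and "c \<le> gprod p x z" "c \<le> gprod p z w" "c \<le> gprod p w y"
  shows "c - 2 * \<delta> \<le> gprod p x y"
  using four_point[of p x w z] four_point[of p x y w] assms delta_nonneg by linarith

end

section \<open>Flow lines and sinks of a Lipschitz map\<close>

locale hyperbolic_map = gromov_hyperbolic +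
  fixes F :: "'a \<Rightarrow> 'a" and L :: real
  assumes map_in: "x \<in> M \<Longrightarrow> F x \<in> M"
    and lipschitz_nonneg: "0 \<le> L"
    and lipschitz: "\<lbrakk>x \<in> M; y \<in> M\<rbrakk> \<Longrightarrow> d (F x) (F y) \<le> L * d x y"
begin

text \<open>Near points have near images. If each of them heads towards the end of its own geodesic,
  the two ends therefore lie in the same direction, and the geodesics cannot separate in the next
  step. The bound is recomputed from the starting points at every step, so errors do not
  accumulate.\<close>

lemma heads_fellow_travel:
  assumes u: "discrete_geodesic u m" and v: "discrete_geodesic v m'"
    and an: "a + n \<le> m" and bn: "b + n \<le> m'"
    and start: "d (u a) (v b) \<le> E"
    and C: "1 + 2 * \<delta> + (L + 2) * (3 * E + 4 * \<delta>) \<le> C"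
    and hu: "\<And>s. s < n \<Longrightarrow> heads F C u m (a + s)"
    and hv: "\<And>s. s < n \<Longrightarrow> heads F C v m' (b + s)"
    and "s \<le> n"
  shows "d (u (a + s)) (v (b + s)) \<le> 3 * E + 4 * \<delta>"
  using \<open>s \<le> n\<close>
proof (induction s)
  case 0
  have "0 \<le> E" using start nonneg[of "u a" "v b"] by linarith
  then show ?case using start delta_nonneg by simp
next
  case (Suc s)
  define e where "e = 3 * E + 4 * \<delta>"
  have E0: "0 \<le> E" using start nonneg[of "u a" "v b"] by linarith
  have e: "0 \<le> e" "E \<le> e" unfolding e_def using E0 delta_nonneg by auto
  define o1 P P' V0 Q Q' x y
    where defs: "o1 = u a" "P = u (a + s)" "P' = u (a + Suc s)"
      "V0 = v b" "Q = v (b + s)" "Q' = v (b + Suc s)" "x = u m" "y = v m'"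
  have inM: "o1 \<in> M" "P \<in> M" "P' \<in> M" "V0 \<in> M" "Q \<in> M" "Q' \<in> M" "x \<in> M" "y \<in> M"
    unfolding defs using u v an bn Suc.prems by (auto intro!: discrete_geodesic_in)
  note inF = map_in[OF inM(2)] map_in[OF inM(5)]
  have PQ: "d P Q \<le> e" using Suc.IH Suc.prems unfolding defs e_def by simp
  have hP: "C < gprod P (F P) x" and hQ: "C < gprod Q (F Q) y"
    using hu[of s] hv[of s] Suc.prems unfolding heads_def defs by auto
  have hQ': "C - e < gprod P (F Q) y"
    using gprod_change_base[of Q P "F Q" y] inM inF hQ PQ by (simp add: commute)
  have "L * d P Q \<le> L * e" using PQ lipschitz_nonneg by (rule mult_left_mono)
  then have FPQ: "d (F P) (F Q) \<le> L * e" using lipschitz[of P Q] inM by linarith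
  have PF: "C < d P (F P)" using gprod_le_dist[of P "F P" x] hP inM inF by linarith
  have mid: "C - L * e \<le> gprod P (F P) (F Q)"
    using gprod_ge_dist_diff[of P "F P" "F Q"] PF FPQ inM inF by linarith
  have Le: "0 \<le> L * e" using e lipschitz_nonneg by simp
  \<comment> \<open>Seen from \<open>P\<close>, the points \<open>x\<close>, \<open>F P\<close>,
    \<open>F Q\<close>, \<open>y\<close> are chained; \<open>C\<close> is chosen so that at least
    \<open>1 + e\<close> remains.\<close>
  have "C - e - L * e - 2 * \<delta> \<le> gprod P x y"
    by (rule four_point_chain[of P x y "F P" "F Q"])
      (use inM inF hP hQ' mid e Le in \<open>auto simp: gprod_commute[of P x]\<close>)
  moreover have "1 + e \<le> C - e - L * e - 2 * \<delta>"
    using C unfolding e_def[symmetric] by (simp add: algebra_simps)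
  ultimately have xy: "1 + e \<le> gprod P x y" by linarith
  have du: "d o1 x = real m - real a" "d P x = real m - real (a + s)"
    "d o1 P' = real s + 1" "d P' x = real m - real (a + Suc s)"
    unfolding defs using u an Suc.prems by (auto simp: discrete_geodesic_dist)
  have dv: "d V0 y = real m' - real b" "d Q y = real m' - real (b + s)"
    "d V0 Q' = real s + 1" "d Q' y = real m' - real (b + Suc s)"
    unfolding defs using v bn Suc.prems by (auto simp: discrete_geodesic_dist)
  have oV: "d o1 V0 \<le> E" using start unfolding defs .
  have oy: "real s + d P y - e - E \<le> d o1 y"
    using triangle[of V0 o1 y] triangle[of P Q y] inM oV PQ dv by (simp add: commute)
  have ox: "d o1 x = real s + d P x" using du by simp
  have c1: "real s + 1 - E \<le> gprod o1 x y"
    using xy oy ox e E0 unfolding gprod_def by (simp add: field_simps)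
  have c2: "real s + 1 - E \<le> gprod o1 P' x"
    using du E0 unfolding gprod_def by simp
  have "gprod V0 y Q' = real s + 1"
    using dv unfolding gprod_def by (simp add: commute[of y Q'])
  then have c3: "real s + 1 - E \<le> gprod o1 y Q'"
    using gprod_change_base[of V0 o1 y Q'] inM oV by (simp add: commute)
  \<comment> \<open>The chain \<open>P'\<close>, \<open>x\<close>, \<open>y\<close>,
    \<open>Q'\<close> seen from the start \<open>o1\<close> loses only terms in \<open>E\<close> and
    \<delta>; the \<open>e\<close> of the induction hypothesis has been absorbed by the margin
    \<open>1 + e\<close>.\<close>
  have "real s + 1 - E - 2 * \<delta> \<le> gprod o1 P' Q'"
    using four_point_chain[OF inM(1,3,6,7,8) c2 c1 c3] .
  moreover have "d o1 Q' \<le> real s + 1 + E"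
    using triangle[of o1 V0 Q'] inM oV dv by simp
  ultimately have "d P' Q' \<le> 3 * E + 4 * \<delta>"
    using du unfolding gprod_def by (simp add: field_simps)
  then show ?case unfolding defs .
qed

text \<open>Just before a sink the direction is unknown for \<open>T\<close> steps; walking them
  costs at most \<open>T\<close> on each geodesic.\<close>

lemma heads_fellow_travel_slack:
  assumes u: "discrete_geodesic u m" and v: "discrete_geodesic v m'"
    and an: "a + n \<le> m" and bn: "b + n \<le> m'"
    and start: "d (u a) (v b) \<le> E"
    and C: "1 + 2 * \<delta> + (L + 2) * (3 * E + 4 * \<delta>) \<le> C"
    and hu: "\<And>s. s + T < n \<Longrightarrow> heads F C u m (a + s)"
    and hv: "\<And>s. s + T < n \<Longrightarrow> heads F C v m' (b + s)"
    and s: "s \<le> n"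
  shows "d (u (a + s)) (v (b + s)) \<le> 3 * E + 4 * \<delta> + 2 * real T"
proof -
  define r where "r = min s (n - T)"
  have r: "r \<le> s" "real s - real r \<le> real T" "r \<le> n - T" "r \<le> n" using s by (auto simp: r_def)
  have *: "d (u (a + r)) (v (b + r)) \<le> 3 * E + 4 * \<delta>"
    by (rule heads_fellow_travel[OF u v _ _ start C, where n = "n - T"])
      (use an bn hu hv r in auto)
  have "d (u (a + s)) (u (a + r)) \<le> real T" "d (v (b + r)) (v (b + s)) \<le> real T"
    using discrete_geodesic_dist'[OF u, of "a + r" "a + s"]
      discrete_geodesic_dist[OF v, of "b + r" "b + s"] r s an bn by auto
  moreover have "u (a + s) \<in> M" "u (a + r) \<in> M" "v (b + s) \<in> M" "v (b + r) \<in> M"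
    using r s an bn by (auto intro!: discrete_geodesic_in[OF u] discrete_geodesic_in[OF v])
  ultimately show ?thesis
    using * triangle[of "u (a + s)" "u (a + r)" "v (b + s)"]
      triangle[of "u (a + r)" "v (b + r)" "v (b + s)"] by linarith
qed

text \<open>The image of \<open>u i\<close> is not far ahead of \<open>u i\<close>, so
  \<open>u j\<close> sees it behind itself, in the direction of \<open>u i\<close> and hence of
  \<open>u 0\<close>. The image of \<open>u j\<close> is close to it compared with the displacement
  of \<open>u j\<close>, so it lies in that direction too.\<close>

lemma turn_back:
  assumes u: "discrete_geodesic u m" and ij: "i \<le> j" "j \<le> m"
    and nh: "\<not> heads F C u m i"
    and T: "2 * C + 2 * \<delta> < real j - real i"
    and D: "C + 2 * \<delta> + L * (real j - real i) < d (u j) (F (u j))"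
    and C: "0 \<le> C"
  shows "C < gprod (u j) (F (u j)) (u 0)"
proof -
  define t where "t = real j - real i"
  define x y z w where defs: "x = u i" "y = u j" "z = u m" "w = u 0"
  have inM: "x \<in> M" "y \<in> M" "z \<in> M" "w \<in> M"
    unfolding defs using ij by (auto intro!: discrete_geodesic_in[OF u])
  note inF = map_in[OF inM(1)] map_in[OF inM(2)]
  have dist: "d x y = t" "d y z = real m - real j" "d x z = real m - real i"
    "d y w = real j" "d x w = real i"
    unfolding defs t_def using u ij by (auto simp: discrete_geodesic_dist discrete_geodesic_dist')
  have "gprod x (F x) z \<le> C" using nh unfolding heads_def defs by simp
  moreover have "d (F x) z \<le> d (F x) y + d y z" using triangle inM inF by auto
  ultimately have g1: "t - C \<le> gprod y (F x) x"
    using dist unfolding gprod_def t_def by (simp add: commute field_simps)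
  have g2: "t - C \<le> gprod y x w"
    using dist C unfolding gprod_def t_def by (simp add: commute field_simps)
  have "d (F y) (F x) \<le> L * t" using lipschitz[of y x] inM dist by (simp add: commute)
  then have g3: "C + 2 * \<delta> < gprod y (F y) (F x)"
    using gprod_ge_dist_diff[of y "F y" "F x"] D inM inF unfolding t_def defs by linarith
  define c where "c = min (t - C) (gprod y (F y) (F x))"
  have "c - 2 * \<delta> \<le> gprod y (F y) w"
    by (rule four_point_chain[of y "F y" w "F x" x]) (use inM inF g1 g2 in \<open>auto simp: c_def\<close>)
  moreover have "C + 2 * \<delta> < c" using T g3 unfolding c_def t_def by linarith
  ultimately show ?thesis unfolding defs by linarith
qed

text \<open>Seen from a point of the geodesic, the two ends have Gromov product 0, so no third point
  can lie in both directions beyond \<delta>.\<close>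

lemma not_heads_both_ways:
  assumes u: "discrete_geodesic u m" and j: "j \<le> m" and C: "\<delta> \<le> C"
    and "C < gprod (u j) (F (u j)) (u 0)"
  shows "\<not> heads F C u m j"
proof -
  have inM: "u j \<in> M" "u 0 \<in> M" "u m \<in> M" "F (u j) \<in> M"
    using discrete_geodesic_in[OF u] map_in j by auto
  have "gprod (u j) (u 0) (u m) = 0"
    unfolding gprod_def using u j by (simp add: discrete_geodesic_dist discrete_geodesic_dist')
  then have "min (gprod (u j) (u 0) (F (u j))) (gprod (u j) (F (u j)) (u m)) \<le> \<delta>"
    using four_point[OF inM(1,2,3,4)] by linarith
  then show ?thesis using assms unfolding heads_def by (auto simp: gprod_commute)
qed

text \<open>A point that looks back does not head forward, so \<open>turn_back\<close> can be
  applied again from there. The steps have length between \<open>T\<close> and \<open>2 * T\<close>: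
  long enough for \<open>turn_back\<close>, short enough for one displacement bound to serve all of
  them.\<close>

lemma stays_turned_back:
  assumes u: "discrete_geodesic u m" and C: "\<delta> \<le> C"
    and T: "2 * C + 2 * \<delta> < real T"
    and D: "\<And>i. R \<le> i \<Longrightarrow> i \<le> N \<Longrightarrow> C + 2 * \<delta> + L * (2 * real T) < d (u i) (F (u i))"
    and N: "N \<le> m" and i: "R \<le> i" and nh: "\<not> heads F C u m i"
    and j: "i + T \<le> j" "j \<le> N"
  shows "C < gprod (u j) (F (u j)) (u 0)"
  using j
proof (induction j rule: less_induct)
  case (less j)
  define i' where "i' = (if j \<le> i + 2 * T then i else j - T)"
  have i': "i' \<le> j" "T \<le> j - i'" "j - i' \<le> 2 * T"
    using less.prems by (auto simp: i'_def)
  have "0 < T" using T C delta_nonneg by (cases T) auto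
  have "\<not> heads F C u m i'"
  proof (cases "j \<le> i + 2 * T")
    case True
    then show ?thesis using nh by (simp add: i'_def)
  next
    case False
    then have "C < gprod (u i') (F (u i')) (u 0)"
      using less.IH[of i'] less.prems \<open>0 < T\<close> by (simp add: i'_def)
    then show ?thesis using not_heads_both_ways[OF u _ C] i' less.prems N by simp
  qed
  moreover have "L * (real j - real i') \<le> L * (2 * real T)"
    using i' lipschitz_nonneg by (intro mult_left_mono) auto
  moreover have "C + 2 * \<delta> + L * (2 * real T) < d (u j) (F (u j))"
    using D[of j] less.prems i by simp
  ultimately show ?case
    using turn_back[OF u, of i' j C] i' T less.prems N C delta_nonneg by auto
qed

text \<open>If heading failed at the larger threshold, the geodesic would be turned back
  \<open>T\<close> steps later, where it still heads forward at the smaller one. So a threshold can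
  be raised at the cost of the last \<open>T\<close> indices.\<close>

lemma heads_upgrade:
  assumes u: "discrete_geodesic u m" and C: "\<delta> \<le> C" "C \<le> C'"
    and T: "2 * C' + 2 * \<delta> < real T"
    and D: "\<And>i. R \<le> i \<Longrightarrow> i \<le> N \<Longrightarrow> C' + 2 * \<delta> + L * (2 * real T) < d (u i) (F (u i))"
    and N: "N \<le> m" and h: "\<And>i. R \<le> i \<Longrightarrow> i < n \<Longrightarrow> heads F C u m i"
    and n: "n \<le> Suc N" and i: "R \<le> i" "i + T < n"
  shows "heads F C' u m i"
proof (rule ccontr)
  assume "\<not> heads F C' u m i"
  then have "C' < gprod (u (i + T)) (F (u (i + T))) (u 0)"
    using stays_turned_back[OF u _ T D N i(1), of "i + T"] C i n by auto
  then have "\<not> heads F C u m (i + T)"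
    using not_heads_both_ways[OF u _ C(1), of "i + T"] C i n N by simp
  then show False using h[of "i + T"] i by simp
qed

text \<open>Two thresholds are needed: flow lines meeting at the sink are only known to be close up to a
  multiple of \<open>T\<close>, hence of \<open>C\<close>, and following them further requires a threshold \<open>C'\<close> that is
  large compared with this distance.\<close>

lemma sink_exists:
  assumes u: "discrete_geodesic u m" and C: "\<delta> \<le> C" "C \<le> C'"
    and T: "2 * C + 2 * \<delta> < real T" and T': "2 * C' + 2 * \<delta> < real T'"
    and D: "\<And>i. R \<le> i \<Longrightarrow> i + R \<le> m \<Longrightarrow>
      C' + 2 * \<delta> + L * (2 * real (T + T')) < d (u i) (F (u i))"
    and m: "2 * R \<le> m"
  obtains s where "R \<le> s" "s + R \<le> m"
    "\<And>i. R \<le> i \<Longrightarrow> i + T < s \<Longrightarrow> heads F C u m i"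
    "\<And>i. R \<le> i \<Longrightarrow> i + (T + T') < s \<Longrightarrow> heads F C' u m i"
    "\<And>i. R \<le> i \<Longrightarrow> i + T < m - s \<Longrightarrow> heads F C (\<lambda>i. u (m - i)) m i"
    "\<And>i. R \<le> i \<Longrightarrow> i + (T + T') < m - s \<Longrightarrow> heads F C' (\<lambda>i. u (m - i)) m i"
proof -
  define v where "v = (\<lambda>i. u (m - i))"
  have v: "discrete_geodesic v m" unfolding v_def by (rule discrete_geodesic_rev[OF u])
  \<comment> \<open>The sink is the first place where heading forward fails; if it does not fail in
    the admissible range, \<open>m - R\<close> is the default.\<close>
  define s where "s = (LEAST i. R \<le> i \<and> (\<not> heads F C u m i \<or> m \<le> i + R))"
  have ex: "R \<le> m - R \<and> (\<not> heads F C u m (m - R) \<or> m \<le> (m - R) + R)" using m by auto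
  have s: "R \<le> s" "\<not> heads F C u m s \<or> m \<le> s + R"
    using LeastI[of "\<lambda>i. R \<le> i \<and> (\<not> heads F C u m i \<or> m \<le> i + R)", OF ex]
    unfolding s_def by auto
  have sm: "s \<le> m - R" unfolding s_def by (rule Least_le) (rule ex)
  have hs: "heads F C u m i" if "R \<le> i" "i < s" for i
    using not_less_Least[of i "\<lambda>i. R \<le> i \<and> (\<not> heads F C u m i \<or> m \<le> i + R)"] that
    unfolding s_def by auto
  have Lm: "L * (2 * real T) \<le> L * (2 * real (T + T'))" "L * (2 * real T') \<le> L * (2 * real (T + T'))"
    using lipschitz_nonneg by (auto intro!: mult_left_mono)
  have hv: "heads F C v m i" if "R \<le> i" "i + T \<le> m - s" for i
  proof -
    \<comment> \<open>With the default value of \<open>s\<close> no index \<open>i\<close> would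
      satisfy the assumptions, because \<open>0 < T\<close>; so heading really fails at
      \<open>s\<close>.\<close>
    have "0 < T" using T C delta_nonneg by (cases T) auto
    then have nh: "\<not> heads F C u m s" using s that sm by auto
    have "C < gprod (u (m - i)) (F (u (m - i))) (u 0)"
    proof (rule stays_turned_back[OF u C(1) T, where R = R and N = "m - R", OF _ _ s(1) nh])
      show "C + 2 * \<delta> + L * (2 * real T) < d (u i) (F (u i))" if "R \<le> i" "i \<le> m - R" for i
        using D[of i] that m Lm C by linarith
    qed (use that sm in auto)
    then show ?thesis using that sm unfolding heads_def v_def by simp
  qed
  show ?thesis
  proof (rule that[OF s(1)])
    show "s + R \<le> m" using sm m by simp
    show "heads F C u m i" if "R \<le> i" "i + T < s" for i
      using hs that by simp
    show "heads F C (\<lambda>i. u (m - i)) m i" if "R \<le> i" "i + T < m - s" for i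
      using hv that unfolding v_def by simp
    show "heads F C' u m i" if "R \<le> i" "i + (T + T') < s" for i
    proof (rule heads_upgrade[OF u C T', where R = R and N = "m - R" and n = s])
      show "C' + 2 * \<delta> + L * (2 * real T') < d (u i) (F (u i))" if "R \<le> i" "i \<le> m - R" for i
        using D[of i] that m Lm by linarith
    qed (use hs that sm in auto)
    show "heads F C' (\<lambda>i. u (m - i)) m i" if "R \<le> i" "i + (T + T') < m - s" for i
      unfolding v_def[symmetric]
    proof (rule heads_upgrade[OF v C T', where R = R and N = "m - R" and n = "m - s - T"])
      show "C' + 2 * \<delta> + L * (2 * real T') < d (v i) (F (v i))" if "R \<le> i" "i \<le> m - R" for i
      proof -
        have "C' + 2 * \<delta> + L * (2 * real (T + T')) < d (u (m - i)) (F (u (m - i)))"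
          by (rule D) (use that m in auto)
        then show ?thesis using Lm unfolding v_def by linarith
      qed
    qed (use hv that s in auto)
  qed
qed

end

section \<open>Word metrics and Cayley graphs\<close>

text \<open>On the side from \<open>x\<close> to \<open>y\<close> there is a point \<open>q\<close>
  near both sides at \<open>p\<close>; its distance from \<open>p\<close> exceeds
  \<open>gprod p x y\<close> by at most a constant. In the triangle with third vertex
  \<open>z\<close>, \<open>q\<close> is near a side at \<open>z\<close>, and every point of that
  side is at least as far from \<open>p\<close> as the corresponding Gromov product.\<close>

lemma (in Metric_space) slim_imp_four_point:
  assumes geo: "\<And>x y. x \<in> M \<Longrightarrow> y \<in> M \<Longrightarrow> \<exists>u m. discrete_geodesic u m \<and> u 0 = x \<and> u m = y"
    and slim: "\<And>u v w m n l i. \<lbrakk>discrete_geodesic u m; discrete_geodesic v n; discrete_geodesic w l;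
        u m = v 0; v n = w 0; w l = u 0; i \<le> m\<rbrakk> \<Longrightarrow>
        (\<exists>j\<le>n. d (u i) (v j) \<le> \<epsilon>) \<or> (\<exists>j\<le>l. d (u i) (w j) \<le> \<epsilon>)"
    and eps: "0 \<le> \<epsilon>" and inM: "p \<in> M" "x \<in> M" "y \<in> M" "z \<in> M"
  shows "min (gprod p x z) (gprod p z y) - 3 * (\<epsilon> + 1) \<le> gprod p x y"
proof -
  obtain u m where u: "discrete_geodesic u m" "u 0 = x" "u m = y" using geo inM by blast
  obtain v n where v: "discrete_geodesic v n" "v 0 = y" "v n = p" using geo inM by blast
  obtain w l where w: "discrete_geodesic w l" "w 0 = p" "w l = x" using geo inM by blast
  have uM: "u i \<in> M" if "i \<le> m" for i using discrete_geodesic_in[OF u(1) that] .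
  let ?near = "\<lambda>i. i \<le> m \<and> (\<exists>j\<le>l. d (u i) (w j) \<le> \<epsilon>)"
  have "?near 0" using w u inM eps by auto
  \<comment> \<open>The vertex after the last one near \<open>w\<close> must be near
    \<open>v\<close>; this one step is the 1 in \<open>\<epsilon> + 1\<close>.\<close>
  define i where "i = (GREATEST i. ?near i)"
  have near: "?near i" unfolding i_def by (rule GreatestI_nat[of ?near 0 m]) (use \<open>?near 0\<close> in auto)
  have "\<exists>j\<le>n. d (u i) (v j) \<le> \<epsilon> + 1"
  proof (cases "i = m")
    case True
    then show ?thesis using u v inM eps by auto
  next
    case False
    have "\<not> ?near (Suc i)"
      using Greatest_le_nat[of ?near "Suc i" m] unfolding i_def by auto
    then have i: "Suc i \<le> m" "\<not> (\<exists>j\<le>l. d (u (Suc i)) (w j) \<le> \<epsilon>)" using False near by auto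
    then obtain j where j: "j \<le> n" "d (u (Suc i)) (v j) \<le> \<epsilon>"
      using slim[OF u(1) v(1) w(1), of "Suc i"] u v w by auto
    have "d (u i) (u (Suc i)) = 1" using discrete_geodesic_dist[OF u(1), of i "Suc i"] i by simp
    then have "d (u i) (v j) \<le> \<epsilon> + 1"
      using j triangle[of "u i" "u (Suc i)" "v j"] uM i discrete_geodesic_in[OF v(1) j(1)] by simp
    then show ?thesis using j by blast
  qed
  then obtain jv where jv: "jv \<le> n" "d (u i) (v jv) \<le> \<epsilon> + 1" by blast
  obtain jw where jw: "jw \<le> l" "d (u i) (w jw) \<le> \<epsilon>" using near by blast
  define q a b where defs: "q = u i" "a = w jw" "b = v jv"
  have qab: "q \<in> M" "a \<in> M" "b \<in> M"
    unfolding defs using uM near discrete_geodesic_in[OF v(1) jv(1)] discrete_geodesic_in[OF w(1) jw(1)] by auto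
  have "d p a + d a x = d p x" "d b p + d y b = d y p" "d x q + d q y = d x y"
    unfolding defs
    using discrete_geodesic_dist[OF w(1), of 0 jw] discrete_geodesic_dist[OF w(1), of jw l]
      discrete_geodesic_dist[OF w(1), of 0 l] discrete_geodesic_dist[OF v(1), of 0 jv]
      discrete_geodesic_dist[OF v(1), of jv n] discrete_geodesic_dist[OF v(1), of 0 n]
      discrete_geodesic_dist[OF u(1), of 0 i] discrete_geodesic_dist[OF u(1), of i m]
      discrete_geodesic_dist[OF u(1), of 0 m] u v w jv jw near by auto
  moreover have "d q a \<le> \<epsilon>" "d q b \<le> \<epsilon> + 1" using jv jw unfolding defs by auto
  moreover have "d p q \<le> d p a + d q a" "d p q \<le> d b p + d q b" "d x q \<le> d a x + d q a" "d q y \<le> d y b + d q b"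
    using triangle[of p a q] triangle[of p b q] triangle[of x a q] triangle[of q b y] inM qab
    by (simp_all add: commute)
  ultimately have pq: "d p q \<le> gprod p x y + 2 * (\<epsilon> + 1)"
    unfolding gprod_def commute[of p y] by (simp add: field_simps)
  obtain v' n' where v': "discrete_geodesic v' n'" "v' 0 = y" "v' n' = z" using geo inM by blast
  obtain w' l' where w': "discrete_geodesic w' l'" "w' 0 = z" "w' l' = x" using geo inM by blast
  have between: "gprod p s t \<le> d p c"
    if "d s c + d c t = d s t" "s \<in> M" "t \<in> M" "c \<in> M" for s t c
    using triangle[of p c s] triangle[of p c t] that inM by (simp add: gprod_def commute)
  from slim[OF u(1) v'(1) w'(1), of i] u v' w' near
  consider j where "j \<le> n'" "d q (v' j) \<le> \<epsilon>" | j where "j \<le> l'" "d q (w' j) \<le> \<epsilon>"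
    unfolding defs by auto
  then show ?thesis
  proof cases
    case 1
    have c: "v' j \<in> M" using discrete_geodesic_in[OF v'(1) 1(1)] .
    have "gprod p y z \<le> d p (v' j)"
      using discrete_geodesic_dist[OF v'(1), of 0 j] discrete_geodesic_dist[OF v'(1), of j n']
        discrete_geodesic_dist[OF v'(1), of 0 n'] 1 v' c inM by (intro between) auto
    moreover have "d p (v' j) \<le> d p q + \<epsilon>" using triangle[of p q "v' j"] inM qab c 1 by simp
    ultimately show ?thesis using pq eps gprod_commute[of p y z] by (simp add: min_le_iff_disj)
  next
    case 2
    have c: "w' j \<in> M" using discrete_geodesic_in[OF w'(1) 2(1)] .
    have "gprod p z x \<le> d p (w' j)"
      using discrete_geodesic_dist[OF w'(1), of 0 j] discrete_geodesic_dist[OF w'(1), of j l']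
        discrete_geodesic_dist[OF w'(1), of 0 l'] 2 w' c inM by (intro between) auto
    moreover have "d p (w' j) \<le> d p q + \<epsilon>" using triangle[of p q "w' j"] inM qab c 2 by simp
    ultimately show ?thesis using pq eps gprod_commute[of p z x] by (simp add: min_le_iff_disj)
  qed
qed

section \<open>Word length and the word metric\<close>

locale generated_group = group G for G (structure) +
  fixes A :: "'a set"
  assumes finite_gens: "finite A" and gens_carrier: "A \<subseteq> carrier G"
    and generate_gens: "generate G A = carrier G"
begin

definition letters :: "'a set" where "letters = A \<union> m_inv G ` A"

definition word_val :: "'a list \<Rightarrow> 'a" where "word_val w = foldr (\<lambda>a b. a \<otimes> b) w \<one>"

abbreviation len :: "'a \<Rightarrow> nat" where "len \<equiv> word_length G A"

lemma letters_carrier: "letters \<subseteq> carrier G"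
  using gens_carrier by (auto simp: letters_def)

lemma word_val_simps [simp]: "word_val [] = \<one>" "word_val (a # w) = a \<otimes> word_val w"
  by (simp_all add: word_val_def)

lemma word_val_closed: "set w \<subseteq> letters \<Longrightarrow> word_val w \<in> carrier G"
  using letters_carrier by (induction w) auto

lemma word_val_append:
  "set w \<subseteq> letters \<Longrightarrow> set w' \<subseteq> letters \<Longrightarrow> word_val (w @ w') = word_val w \<otimes> word_val w'"
proof (induction w)
  case (Cons a w)
  then show ?case
    using letters_carrier word_val_closed[of w] word_val_closed[of w'] by (auto simp: m_assoc)
qed (simp add: word_val_closed)

lemma letters_inv: "a \<in> letters \<Longrightarrow> inv a \<in> letters"
  using gens_carrier by (auto simp: letters_def)

lemma word_val_rev_inv:
  "set w \<subseteq> letters \<Longrightarrow> word_val (rev (map (m_inv G) w)) = inv (word_val w)"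
proof (induction w)
  case (Cons a w)
  then have c: "a \<in> letters" "a \<in> carrier G" "set w \<subseteq> letters" using letters_carrier by auto
  have "word_val (rev (map (m_inv G) (a # w))) = inv (word_val w) \<otimes> inv a"
    using word_val_append[of "rev (map (m_inv G) w)" "[inv a]"] c letters_inv Cons.IH by auto
  then show ?case using c word_val_closed[of w] by (simp add: inv_mult_group)
qed simp

lemma word_exists: "x \<in> carrier G \<Longrightarrow> \<exists>w. set w \<subseteq> letters \<and> word_val w = x"
  unfolding generate_gens[symmetric]
proof (induction rule: generate.induct)
  case one
  then show ?case by (intro exI[of _ "[]"]) simp
next
  case (incl h)
  then show ?case using gens_carrier by (intro exI[of _ "[h]"]) (auto simp: letters_def)
next
  case (inv h)
  then show ?case using gens_carrier by (intro exI[of _ "[inv h]"]) (auto simp: letters_def)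
next
  case (eng h1 h2)
  then obtain w1 w2 where "set w1 \<subseteq> letters" "word_val w1 = h1" "set w2 \<subseteq> letters" "word_val w2 = h2"
    by blast
  then show ?case by (intro exI[of _ "w1 @ w2"]) (simp add: word_val_append)
qed

lemma len_le: "set w \<subseteq> letters \<Longrightarrow> len (word_val w) \<le> length w"
  unfolding word_length_def letters_def word_val_def by (rule Least_le) auto

lemma shortest_word:
  assumes "x \<in> carrier G"
  obtains w where "set w \<subseteq> letters" "word_val w = x" "length w = len x"
proof -
  let ?P = "\<lambda>n. \<exists>w. length w = n \<and> set w \<subseteq> A \<union> m_inv G ` A \<and> foldr (\<lambda>a b. a \<otimes> b) w \<one> = x"
  have "\<exists>n. ?P n" using word_exists[OF assms] unfolding letters_def word_val_def by blast
  then have "?P (len x)" unfolding word_length_def by (rule LeastI_ex)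
  then show ?thesis using that unfolding letters_def word_val_def by blast
qed

lemma len_one [simp]: "len \<one> = 0"
  using len_le[of "[]"] by simp

lemma len_eq_0: "x \<in> carrier G \<Longrightarrow> len x = 0 \<longleftrightarrow> x = \<one>"
  by (metis len_one length_0_conv shortest_word word_val_simps(1))

lemma len_mult: "x \<in> carrier G \<Longrightarrow> y \<in> carrier G \<Longrightarrow> len (x \<otimes> y) \<le> len x + len y"
proof -
  assume xy: "x \<in> carrier G" "y \<in> carrier G"
  obtain w w' where w: "set w \<subseteq> letters" "word_val w = x" "length w = len x"
    and w': "set w' \<subseteq> letters" "word_val w' = y" "length w' = len y"
    using shortest_word xy by metis
  then show ?thesis using len_le[of "w @ w'"] by (simp add: word_val_append)
qed

lemma len_inv_le: "x \<in> carrier G \<Longrightarrow> len (inv x) \<le> len x"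
proof -
  assume x: "x \<in> carrier G"
  obtain w where w: "set w \<subseteq> letters" "word_val w = x" "length w = len x"
    using shortest_word x by metis
  then show ?thesis
    using len_le[of "rev (map (m_inv G) w)"] letters_inv
    by (auto simp: word_val_rev_inv image_subset_iff subset_iff)
qed

lemma len_inv: "x \<in> carrier G \<Longrightarrow> len (inv x) = len x"
  using len_inv_le[of x] len_inv_le[of "inv x"] by simp

lemma finite_len_ball: "finite {x \<in> carrier G. len x \<le> n}"
proof (rule finite_subset)
  show "{x \<in> carrier G. len x \<le> n} \<subseteq> word_val ` {w. set w \<subseteq> letters \<and> length w \<le> n}"
  proof safe
    fix x assume "x \<in> carrier G" "len x \<le> n"
    then show "x \<in> word_val ` {w. set w \<subseteq> letters \<and> length w \<le> n}"
      using shortest_word[of x] by (metis (mono_tags, lifting) image_eqI mem_Collect_eq)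
  qed
  show "finite (word_val ` {w. set w \<subseteq> letters \<and> length w \<le> n})"
    using finite_gens by (intro finite_imageI finite_lists_length_le) (simp add: letters_def)
qed

text \<open>\<^const>\<open>Metric_space\<close> demands symmetry also off the carrier, where \<^const>\<open>word_metric\<close> is junk.\<close>

definition wdist :: "'a \<Rightarrow> 'a \<Rightarrow> real" where
  "wdist x y = (if x \<in> carrier G \<and> y \<in> carrier G then word_metric G A x y else 0)"

lemma wdist_eq: "x \<in> carrier G \<Longrightarrow> y \<in> carrier G \<Longrightarrow> wdist x y = real (len (inv x \<otimes> y))"
  by (simp add: wdist_def word_metric_def)

lemma Metric_space_wdist: "Metric_space (carrier G) wdist"
proof
  show "0 \<le> wdist x y" for x y by (simp add: wdist_def word_metric_def)
  show "wdist x y = wdist y x" for x y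
  proof (cases "x \<in> carrier G \<and> y \<in> carrier G")
    case True
    then show ?thesis using len_inv[of "inv x \<otimes> y"] by (simp add: wdist_eq inv_mult_group)
  qed (auto simp: wdist_def)
  show "wdist x y = 0 \<longleftrightarrow> x = y" if "x \<in> carrier G" "y \<in> carrier G" for x y
  proof -
    have "wdist x y = 0 \<longleftrightarrow> inv x \<otimes> y = \<one>" using that by (simp add: wdist_eq len_eq_0)
    also have "\<dots> \<longleftrightarrow> x = y" using that by (metis inv_equality inv_inv inv_closed l_inv)
    finally show ?thesis .
  qed
  show "wdist x z \<le> wdist x y + wdist y z"
    if "x \<in> carrier G" "y \<in> carrier G" "z \<in> carrier G" for x y z
  proof -
    have "y \<otimes> (inv y \<otimes> z) = z" using that by (simp add: m_assoc[symmetric])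
    then have "(inv x \<otimes> y) \<otimes> (inv y \<otimes> z) = inv x \<otimes> z" using that by (simp add: m_assoc)
    then show ?thesis
      using len_mult[of "inv x \<otimes> y" "inv y \<otimes> z"] that by (simp add: wdist_eq)
  qed
qed

sublocale wm: Metric_space "carrier G" wdist
  by (rule Metric_space_wdist)

lemma wdist_left_invariant:
  assumes "x \<in> carrier G" "y \<in> carrier G" "z \<in> carrier G"
  shows "wdist (z \<otimes> x) (z \<otimes> y) = wdist x y"
proof -
  have "inv z \<otimes> (z \<otimes> y) = y" using assms by (simp add: m_assoc[symmetric])
  then have "inv (z \<otimes> x) \<otimes> (z \<otimes> y) = inv x \<otimes> y"
    using assms by (simp add: inv_mult_group m_assoc)
  then show ?thesis using assms by (simp add: wdist_eq)
qed

lemma finite_wdist_ball: "finite {x \<in> carrier G. wdist \<one> x \<le> r}"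
proof (rule finite_subset)
  show "{x \<in> carrier G. wdist \<one> x \<le> r} \<subseteq> {x \<in> carrier G. len x \<le> nat \<lfloor>r\<rfloor>}"
    by (auto simp: wdist_eq le_nat_floor)
qed (rule finite_len_ball)

text \<open>The prefixes of a shortest word for \<open>inv x \<otimes> y\<close>, translated by
  \<open>x\<close>, trace a geodesic.\<close>

lemma geodesic_exists:
  assumes xy: "x \<in> carrier G" "y \<in> carrier G"
  shows "\<exists>u m. wm.discrete_geodesic u m \<and> u 0 = x \<and> u m = y"
proof -
  obtain w where w: "set w \<subseteq> letters" "word_val w = inv x \<otimes> y" "length w = len (inv x \<otimes> y)"
    using shortest_word[of "inv x \<otimes> y"] xy by auto
  define m where "m = length w"
  define u where "u i = x \<otimes> word_val (take i w)" for i
  have tl: "set (take i w) \<subseteq> letters" "set (take i (drop j w)) \<subseteq> letters" "set (drop i w) \<subseteq> letters" for i j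
    using w(1) by (meson order_trans set_take_subset set_drop_subset)+
  have uc: "u i \<in> carrier G" for i using xy tl word_val_closed by (simp add: u_def)
  have u0: "u 0 = x" using xy by (simp add: u_def)
  have um: "u m = y" using xy w by (simp add: u_def m_def m_assoc[symmetric])
  have upper: "wdist (u i) (u j) \<le> real j - real i" if "i \<le> j" "j \<le> m" for i j
  proof -
    have "take j w = take i w @ take (j - i) (drop i w)"
      using that by (metis le_add_diff_inverse take_add)
    then have "u j = u i \<otimes> word_val (take (j - i) (drop i w))"
      using tl xy by (simp add: u_def word_val_append word_val_closed m_assoc)
    then have "inv (u i) \<otimes> u j = word_val (take (j - i) (drop i w))"
      using uc tl word_val_closed by (simp add: m_assoc[symmetric])
    moreover have "len (word_val (take (j - i) (drop i w))) \<le> j - i"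
      using len_le[OF tl(2), of "j - i" i] by simp
    ultimately show ?thesis using that uc by (simp add: wdist_eq)
  qed
  \<comment> \<open>The upper bounds of the three pieces add up to the full distance
    \<open>m\<close>, so each of them is attained.\<close>
  have eq: "wdist (u i) (u j) = real j - real i" if "i \<le> j" "j \<le> m" for i j
  proof -
    have "real m = wdist (u 0) (u m)" unfolding u0 um using xy w by (simp add: wdist_eq m_def)
    then show ?thesis
      using upper[of 0 i] upper[of i j] upper[of j m] that
        wm.triangle[of "u 0" "u i" "u m"] wm.triangle[of "u i" "u j" "u m"] uc by simp
  qed
  have "wm.discrete_geodesic u m"
    unfolding wm.discrete_geodesic_def
  proof (intro conjI allI impI uc)
    fix i j assume "i \<le> m" "j \<le> m"
    then show "wdist (u i) (u j) = \<bar>real i - real j\<bar>"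
      using eq[of i j] eq[of j i] wm.commute[of "u i" "u j"] by (cases "i \<le> j") auto
  qed
  then show ?thesis using u0 um by blast
qed

text \<open>A word is mapped letter by letter, so the greatest length of the image of a generator is
  a Lipschitz constant; inverse letters give the same lengths.\<close>

lemma hom_lipschitz:
  assumes "\<phi> \<in> hom G G"
  obtains L where "0 \<le> L"
    "\<And>x y. x \<in> carrier G \<Longrightarrow> y \<in> carrier G \<Longrightarrow> wdist (\<phi> x) (\<phi> y) \<le> L * wdist x y"
proof -
  interpret h: group_hom G G \<phi> using assms by unfold_locales
  define l where "l = Max (insert 0 ((\<lambda>a. len (\<phi> a)) ` A))"
  have gen: "len (\<phi> a) \<le> l" if "a \<in> A" for a
    unfolding l_def using finite_gens that by (intro Max_ge) auto
  have letter: "len (\<phi> a) \<le> l" if "a \<in> letters" for a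
    using that gen gens_carrier by (auto simp: letters_def len_inv subset_iff)
  have word: "len (\<phi> (word_val w)) \<le> l * length w" if "set w \<subseteq> letters" for w
    using that
  proof (induction w)
    case (Cons a w)
    then have "a \<in> carrier G" "word_val w \<in> carrier G" using letters_carrier word_val_closed by auto
    then have "len (\<phi> (word_val (a # w))) \<le> len (\<phi> a) + len (\<phi> (word_val w))"
      by (simp add: len_mult)
    then show ?case using Cons letter[of a] by (simp add: algebra_simps)
  qed simp
  have "wdist (\<phi> x) (\<phi> y) \<le> real l * wdist x y" if xy: "x \<in> carrier G" "y \<in> carrier G" for x y
  proof -
    obtain w where w: "set w \<subseteq> letters" "word_val w = inv x \<otimes> y" "length w = len (inv x \<otimes> y)"
      using shortest_word[of "inv x \<otimes> y"] xy by auto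
    then have "len (inv (\<phi> x) \<otimes> \<phi> y) \<le> l * len (inv x \<otimes> y)"
      using word[of w] xy by simp
    then show ?thesis using xy by (simp add: wdist_eq flip: of_nat_mult)
  qed
  then show ?thesis using that[of "real l"] by simp
qed

section \<open>Discrete geodesics in the realized Cayley graph\<close>

lemma geodesic_edges:
  assumes u: "wm.discrete_geodesic u m"
  obtains g a :: "nat \<Rightarrow> 'a" and b :: "nat \<Rightarrow> bool" where
    "\<And>i. i < m \<Longrightarrow> g i \<in> carrier G \<and> a i \<in> A \<and>
      (if b i then g i = u i \<and> g i \<otimes> a i = u (Suc i) else g i = u (Suc i) \<and> g i \<otimes> a i = u i)"
proof -
  have "\<exists>g a b. g \<in> carrier G \<and> a \<in> A \<and>
      (if b then g = u i \<and> g \<otimes> a = u (Suc i) else g = u (Suc i) \<and> g \<otimes> a = u i)" if "i < m" for i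
  proof -
    have c: "u i \<in> carrier G" "u (Suc i) \<in> carrier G" using wm.discrete_geodesic_in[OF u] that by auto
    have "len (inv (u i) \<otimes> u (Suc i)) = 1"
      using wm.discrete_geodesic_dist[OF u, of i "Suc i"] that c by (simp add: wdist_eq)
    then obtain w where w: "set w \<subseteq> letters" "word_val w = inv (u i) \<otimes> u (Suc i)" "length w = 1"
      using shortest_word[of "inv (u i) \<otimes> u (Suc i)"] c by auto
    then obtain s where "w = [s]" by (auto simp: length_Suc_conv)
    then have s: "s \<in> letters" "s \<in> carrier G" "s = inv (u i) \<otimes> u (Suc i)"
      using w letters_carrier by auto
    then have step: "u i \<otimes> s = u (Suc i)" using c by (simp add: m_assoc[symmetric])
    show ?thesis
    proof (cases "s \<in> A")
      case True
      then show ?thesis using step c by (intro exI[of _ "u i"] exI[of _ s] exI[of _ True]) simp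
    next
      case False
      \<comment> \<open>An inverse letter runs backwards through the edge of its generator, since
        edges are labelled by elements of \<open>A\<close> only; the flag \<open>b\<close> records
        this.\<close>
      then obtain t where t: "t \<in> A" "s = inv t" using s by (auto simp: letters_def)
      have "t \<in> carrier G" using t gens_carrier by auto
      then have "u (Suc i) \<otimes> t = u i" using step t c by (metis inv_closed inv_solve_right')
      then show ?thesis using t c by (intro exI[of _ "u (Suc i)"] exI[of _ t] exI[of _ False]) simp
    qed
  qed
  then show ?thesis using that by metis
qed

text \<open>This carries slimness from the graph over to vertices. For the last claim, a shortest
  path from a vertex to a point of \<open>S\<close> enters through an exit of that point, and all
  these exits are vertices of \<open>u\<close>.\<close>

lemma geodesic_realization:
  assumes u: "wm.discrete_geodesic u m"
  obtains S where
    "geodesic_segment (cayley_graph G A) (cayley_dist G A) (Vertex (u 0)) (Vertex (u m)) S"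
    "\<And>i. i \<le> m \<Longrightarrow> Vertex (u i) \<in> S"
    "\<And>x q r. x \<in> carrier G \<Longrightarrow> q \<in> S \<Longrightarrow> cayley_dist G A (Vertex x) q \<le> r \<Longrightarrow> \<exists>j\<le>m. wdist x (u j) \<le> r"
proof -
  obtain g a b where edge: "\<And>i. i < m \<Longrightarrow> g i \<in> carrier G \<and> a i \<in> A \<and>
      (if b i then g i = u i \<and> g i \<otimes> a i = u (Suc i) else g i = u (Suc i) \<and> g i \<otimes> a i = u i)"
    using geodesic_edges[OF u] by metis
  have uc: "u i \<in> carrier G" if "i \<le> m" for i using wm.discrete_geodesic_in[OF u that] .
  have ud: "word_metric G A (u i) (u j) = \<bar>real i - real j\<bar>" if "i \<le> m" "j \<le> m" for i j
    using u uc that by (simp add: wm.discrete_geodesic_def wdist_def)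
  have uinj: "i = j" if "u i = u j" "i \<le> m" "j \<le> m" for i j
    using u that uc unfolding wm.discrete_geodesic_def
    by (metis abs_eq_0 eq_iff_diff_eq_0 of_nat_eq_iff wm.mdist_zero)
  define lo hi :: "real \<Rightarrow> nat" where "lo t = nat \<lfloor>t\<rfloor>" and "hi t = nat \<lceil>t\<rceil>" for t
  \<comment> \<open>The parameter of an inner point is its distance to \<open>g\<close>, hence the
    complement to 1 on an edge traversed backwards.\<close>
  define \<xi> where "\<xi> t = (if t = real (lo t) then Vertex (u (lo t))
      else Inner (g (lo t)) (a (lo t)) (if b (lo t) then t - real (lo t) else 1 - (t - real (lo t))))" for t
  let ?I = "{0..real m}"
  have lh: "real (lo t) \<le> t" "t \<le> real (hi t)" "hi t \<le> m" "lo t \<le> m" "t < real (lo t) + 1"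
    "real (hi t) < t + 1" if "t \<in> ?I" for t
    using that unfolding lo_def hi_def by (auto simp: nat_le_iff ceiling_le_iff floor_le_iff) linarith+
  have int: "hi t = lo t" if "t \<in> ?I" "t = real (lo t)" for t
    using that unfolding lo_def hi_def by (metis ceiling_of_nat nat_int)
  have nonint: "hi t = Suc (lo t)" "lo t < m" "real (lo t) < t" if "t \<in> ?I" "t \<noteq> real (lo t)" for t
    using lh[OF that(1)] that(2) by linarith+
  have exits: "exits G (\<xi> t) = {(u (lo t), \<bar>t - real (lo t)\<bar>), (u (hi t), \<bar>t - real (hi t)\<bar>)}"
    if "t \<in> ?I" for t
  proof (cases "t = real (lo t)")
    case True
    then show ?thesis using int[OF that True] unfolding \<xi>_def by simp
  next
    case False
    have e: "\<bar>t - real (lo t)\<bar> = t - real (lo t)" "\<bar>t - real (Suc (lo t))\<bar> = 1 - (t - real (lo t))"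
      using lh[OF that] by auto
    show ?thesis
      unfolding nonint(1)[OF that False] e \<xi>_def using False edge[OF nonint(2)[OF that False]]
      by (auto split: if_splits)
  qed
  \<comment> \<open>If \<xi> used an edge twice, \<open>along_edge\<close> could give too small a
    distance; injectivity of \<open>u\<close> excludes this.\<close>
  have same_edge: "i = i'" if "g i = g i'" "a i = a i'" "i < m" "i' < m" for i i'
  proof -
    have "{u i, u (Suc i)} = {u i', u (Suc i')}"
      using edge[OF that(3)] edge[OF that(4)] that(1,2) by (auto split: if_splits)
    then consider "u i = u i'" | "u i = u (Suc i')" "u (Suc i) = u i'"
      by (auto simp: doubleton_eq_iff)
    then show ?thesis
    proof cases
      case 1
      then show ?thesis using uinj[of i i'] that(3,4) by simp
    next
      case 2
      then show ?thesis using uinj[of i "Suc i'"] uinj[of "Suc i" i'] that(3,4) by simp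
    qed
  qed
  have along: "x = \<bar>s - t\<bar>" if "x \<in> along_edge (\<xi> s) (\<xi> t)" "s \<in> ?I" "t \<in> ?I" for s t x
  proof -
    have ne: "s \<noteq> real (lo s)" "t \<noteq> real (lo t)"
      using that(1) unfolding \<xi>_def by (auto split: if_splits)
    then have "g (lo s) = g (lo t)" "a (lo s) = a (lo t)"
      using that(1) unfolding \<xi>_def by (auto split: if_splits)
    then have "lo s = lo t" using same_edge nonint ne that by blast
    then show ?thesis using that(1) ne unfolding \<xi>_def by (auto split: if_splits)
  qed
  have fin: "finite (along_edge p q)" for p q :: "'a cayley_point"
    by (cases p; cases q) auto
  have finx: "finite (exits G p)" for p by (cases p) auto
  have dist: "cayley_dist G A (\<xi> s) (\<xi> t) = \<bar>s - t\<bar>" if st: "s \<in> ?I" "t \<in> ?I" for s t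
    unfolding cayley_dist_def
  proof (rule Min_eqI)
    show "finite (along_edge (\<xi> s) (\<xi> t) \<union>
        (\<lambda>((x, r), y, s). r + word_metric G A x y + s) ` (exits G (\<xi> s) \<times> exits G (\<xi> t)))"
      using fin finx by auto
    show "\<bar>s - t\<bar> \<le> x" if "x \<in> along_edge (\<xi> s) (\<xi> t) \<union>
        (\<lambda>((x, r), y, s). r + word_metric G A x y + s) ` (exits G (\<xi> s) \<times> exits G (\<xi> t))" for x
      using that along[OF _ st] lh[OF st(1)] lh[OF st(2)] unfolding exits[OF st(1)] exits[OF st(2)]
      by (auto simp: ud)
    have via: "\<bar>s - real p\<bar> + \<bar>real p - real q\<bar> + \<bar>t - real q\<bar> \<in>
        (\<lambda>((x, r), y, s). r + word_metric G A x y + s) ` (exits G (\<xi> s) \<times> exits G (\<xi> t))"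
      if "p \<in> {lo s, hi s}" "q \<in> {lo t, hi t}" for p q
    proof -
      have "p \<le> m" "q \<le> m" using that lh[OF st(1)] lh[OF st(2)] by auto
      then have "\<bar>s - real p\<bar> + \<bar>real p - real q\<bar> + \<bar>t - real q\<bar> =
          (\<lambda>((x, r), y, s). r + word_metric G A x y + s) ((u p, \<bar>s - real p\<bar>), (u q, \<bar>t - real q\<bar>))"
        by (simp add: ud)
      moreover have "((u p, \<bar>s - real p\<bar>), (u q, \<bar>t - real q\<bar>)) \<in> exits G (\<xi> s) \<times> exits G (\<xi> t)"
        using that unfolding exits[OF st(1)] exits[OF st(2)] by auto
      ultimately show ?thesis by (rule image_eqI)
    qed
    \<comment> \<open>Either a vertex separates the two parameters and the path runs through
      vertices, or both lie inside the same open edge.\<close>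
    consider "hi s \<le> lo t" | "hi t \<le> lo s" | "lo t < hi s" "lo s < hi t" by linarith
    then show "\<bar>s - t\<bar> \<in> along_edge (\<xi> s) (\<xi> t) \<union>
        (\<lambda>((x, r), y, s). r + word_metric G A x y + s) ` (exits G (\<xi> s) \<times> exits G (\<xi> t))"
    proof cases
      case 1
      then have "\<bar>s - real (hi s)\<bar> + \<bar>real (hi s) - real (lo t)\<bar> + \<bar>t - real (lo t)\<bar> = \<bar>s - t\<bar>"
        using lh[OF st(1)] lh[OF st(2)] by linarith
      then show ?thesis using via[of "hi s" "lo t"] by simp
    next
      case 2
      then have "\<bar>s - real (lo s)\<bar> + \<bar>real (lo s) - real (hi t)\<bar> + \<bar>t - real (hi t)\<bar> = \<bar>s - t\<bar>"
        using lh[OF st(1)] lh[OF st(2)] by linarith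
      then show ?thesis using via[of "lo s" "hi t"] by simp
    next
      case 3
      have ne: "s \<noteq> real (lo s)" "t \<noteq> real (lo t)" using 3 int[OF st(1)] int[OF st(2)]
          lh[OF st(1)] lh[OF st(2)] by linarith+
      then have "lo s = lo t" using 3 nonint[OF st(1)] nonint[OF st(2)] by simp
      then have "\<bar>s - t\<bar> \<in> along_edge (\<xi> s) (\<xi> t)" using ne unfolding \<xi>_def by auto
      then show ?thesis by blast
    qed
  qed
  have vert: "\<xi> (real i) = Vertex (u i)" for i unfolding \<xi>_def lo_def by simp
  show ?thesis
  proof (rule that[of "\<xi> ` ?I"])
    have "\<xi> t \<in> cayley_graph G A" if "t \<in> ?I" for t
    proof (cases "t = real (lo t)")
      case True
      then show ?thesis using uc lh[OF that] unfolding \<xi>_def cayley_graph_def by auto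
    next
      case False
      then show ?thesis using nonint[OF that False] lh[OF that] edge[of "lo t"]
        unfolding \<xi>_def cayley_graph_def by auto
    qed
    then show "geodesic_segment (cayley_graph G A) (cayley_dist G A) (Vertex (u 0)) (Vertex (u m)) (\<xi> ` ?I)"
      unfolding geodesic_segment_def using vert[of 0] vert[of m] dist
      by (intro exI[of _ "real m"] exI[of _ \<xi>]) auto
    show "Vertex (u i) \<in> \<xi> ` ?I" if "i \<le> m" for i
      using that by (intro image_eqI[of _ _ "real i"]) (auto simp: vert)
    show "\<exists>j\<le>m. wdist x (u j) \<le> r"
      if x: "x \<in> carrier G" and q: "q \<in> \<xi> ` ?I" and le: "cayley_dist G A (Vertex x) q \<le> r" for x q r
    proof -
      obtain t where t: "t \<in> ?I" "q = \<xi> t" using q by blast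
      let ?X = "(\<lambda>((x, r), y, s). r + word_metric G A x y + s) ` (exits G (Vertex x) \<times> exits G (\<xi> t))"
      have "cayley_dist G A (Vertex x) q = Min ?X"
        unfolding cayley_dist_def t(2) by simp
      moreover have "Min ?X \<in> ?X" using finx exits[OF t(1)] by (intro Min_in) auto
      ultimately obtain j where "j \<in> {lo t, hi t}"
        "cayley_dist G A (Vertex x) q = word_metric G A x (u j) + \<bar>t - real j\<bar>"
        unfolding exits[OF t(1)] by auto
      then show ?thesis using le lh[OF t(1)] x uc by (intro exI[of _ j]) (auto simp: wdist_def)
    qed
  qed
qed

lemma hyperbolic_imp_gromov_hyperbolic:
  assumes "hyperbolic_wrt G A"
  obtains \<delta> where "gromov_hyperbolic (carrier G) wdist \<delta>"
proof -
  obtain \<epsilon> where eps: "0 \<le> \<epsilon>" "slim_triangles (cayley_graph G A) (cayley_dist G A) \<epsilon>"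
    using assms by (auto simp: hyperbolic_wrt_def)
  have slim: "(\<exists>j\<le>n. wdist (u i) (v j) \<le> \<epsilon>) \<or> (\<exists>j\<le>l. wdist (u i) (w j) \<le> \<epsilon>)"
    if u: "wm.discrete_geodesic u m" and v: "wm.discrete_geodesic v n" and w: "wm.discrete_geodesic w l"
      and ends: "u m = v 0" "v n = w 0" "w l = u 0" and i: "i \<le> m" for u v w m n l i
  proof -
    obtain S1 where S1: "geodesic_segment (cayley_graph G A) (cayley_dist G A) (Vertex (u 0)) (Vertex (u m)) S1"
      "Vertex (u i) \<in> S1" using geodesic_realization[OF u] i by metis
    obtain S2 where S2: "geodesic_segment (cayley_graph G A) (cayley_dist G A) (Vertex (v 0)) (Vertex (v n)) S2"
      "\<And>x q r. x \<in> carrier G \<Longrightarrow> q \<in> S2 \<Longrightarrow> cayley_dist G A (Vertex x) q \<le> r \<Longrightarrow> \<exists>j\<le>n. wdist x (v j) \<le> r"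
      using geodesic_realization[OF v] by metis
    obtain S3 where S3: "geodesic_segment (cayley_graph G A) (cayley_dist G A) (Vertex (w 0)) (Vertex (w l)) S3"
      "\<And>x q r. x \<in> carrier G \<Longrightarrow> q \<in> S3 \<Longrightarrow> cayley_dist G A (Vertex x) q \<le> r \<Longrightarrow> \<exists>j\<le>l. wdist x (w j) \<le> r"
      using geodesic_realization[OF w] by metis
    obtain q where "q \<in> S2 \<union> S3" "cayley_dist G A (Vertex (u i)) q \<le> \<epsilon>"
      using eps(2) S1 S2(1) S3(1) unfolding slim_triangles_def ends by blast
    then show ?thesis using S2(2) S3(2) wm.discrete_geodesic_in[OF u i] by blast
  qed
  have "gromov_hyperbolic (carrier G) wdist (3 * (\<epsilon> + 1))"
  proof
    show "min (wm.gprod p x z) (wm.gprod p z y) - 3 * (\<epsilon> + 1) \<le> wm.gprod p x y"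
      if "p \<in> carrier G" "x \<in> carrier G" "y \<in> carrier G" "z \<in> carrier G" for p x y z
    proof (rule wm.slim_imp_four_point)
      show "\<exists>u m. wm.discrete_geodesic u m \<and> u 0 = x \<and> u m = y"
        if "x \<in> carrier G" "y \<in> carrier G" for x y by (rule geodesic_exists[OF that])
      show "(\<exists>j\<le>n. wdist (u i) (v j) \<le> \<epsilon>) \<or> (\<exists>j\<le>l. wdist (u i) (w j) \<le> \<epsilon>)"
        if "wm.discrete_geodesic u m" "wm.discrete_geodesic v n" "wm.discrete_geodesic w l"
          "u m = v 0" "v n = w 0" "w l = u 0" "i \<le> m" for u v w m n l i
        by (rule slim[OF that])
    qed (use eps(1) that in auto)
  qed (use eps in simp)
  then show ?thesis by (rule that)
qed

end

section \<open>Fixed points of endomorphisms\<close>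

text \<open>Some subsequence is monotone; if it decreases, it is constant once it has reached its
  least value.\<close>

lemma incseq_subseq_nat:
  fixes s :: "nat \<Rightarrow> nat"
  obtains f where "strict_mono f" "incseq (s \<circ> f)"
proof -
  obtain f where f: "strict_mono f" "monoseq (\<lambda>n. s (f n))"
    using seq_monosub by blast
  show ?thesis
  proof (cases "incseq (\<lambda>n. s (f n))")
    case True
    then show ?thesis using that[OF f(1)] by (simp add: comp_def)
  next
    case False
    then have dec: "decseq (\<lambda>n. s (f n))" using f(2) by (simp add: monoseq_iff)
    define c where "c = (LEAST c. c \<in> range (\<lambda>n. s (f n)))"
    have "c \<in> range (\<lambda>n. s (f n))" unfolding c_def by (rule LeastI[of _ "s (f 0)"]) auto
    then obtain N where N: "s (f N) = c" by auto
    have "s (f (N + n)) = c" for n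
    proof (rule antisym)
      show "s (f (N + n)) \<le> c" using decseqD[OF dec, of N "N + n"] N by simp
      show "c \<le> s (f (N + n))" unfolding c_def by (rule Least_le) auto
    qed
    then have "incseq (s \<circ> (\<lambda>n. f (N + n)))" by (simp add: incseq_def)
    moreover have "strict_mono (\<lambda>n. f (N + n))" using f(1) by (simp add: strict_mono_def)
    ultimately show ?thesis using that by blast
  qed
qed

section \<open>Equivariance and displacement of an endomorphism\<close>

locale hyperbolic_endomorphism =
  group G + hyperbolic_map "carrier G" d \<delta> \<phi> L
  for G (structure) and d \<delta> \<phi> L +
  assumes left_invariant:
      "\<lbrakk>x \<in> carrier G; y \<in> carrier G; z \<in> carrier G\<rbrakk> \<Longrightarrow> d (z \<otimes> x) (z \<otimes> y) = d x y"
    and finite_balls: "finite {x \<in> carrier G. d \<one> x \<le> r}"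
    and geodesics: "\<lbrakk>x \<in> carrier G; y \<in> carrier G\<rbrakk> \<Longrightarrow>
      \<exists>u m. discrete_geodesic u m \<and> u 0 = x \<and> u m = y"
    and endomorphism: "\<phi> \<in> hom G G"
begin

abbreviation K :: "'a set" where "K \<equiv> Fix G \<phi>"

lemma phi_mult: "\<lbrakk>x \<in> carrier G; y \<in> carrier G\<rbrakk> \<Longrightarrow> \<phi> (x \<otimes> y) = \<phi> x \<otimes> \<phi> y"
  using endomorphism by (simp add: hom_def)

lemma group_hom_phi: "group_hom G G \<phi>"
  using endomorphism by unfold_locales

lemma subgroup_Fix: "subgroup K G"
proof (rule subgroupI)
  have "\<phi> \<one> = \<one>" by (rule group_hom.hom_one[OF group_hom_phi])
  then show "K \<noteq> {}" unfolding Fix_def by blast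
  show "inv a \<in> K" if "a \<in> K" for a
    using that group_hom.hom_inv[OF group_hom_phi, of a] by (simp add: Fix_def)
qed (auto simp: Fix_def phi_mult)

lemma Fix_carrier: "k \<in> K \<Longrightarrow> k \<in> carrier G"
  by (simp add: Fix_def)

lemma Fix_mult: "k \<in> K \<Longrightarrow> l \<in> K \<Longrightarrow> k \<otimes> l \<in> K"
  using subgroup_Fix by (rule subgroup.m_closed)

lemma Fix_inv: "k \<in> K \<Longrightarrow> inv k \<in> K"
  using subgroup_Fix by (rule subgroup.m_inv_closed)

lemma phi_Fix_mult: "k \<in> K \<Longrightarrow> x \<in> carrier G \<Longrightarrow> \<phi> (k \<otimes> x) = k \<otimes> \<phi> x"
  by (simp add: Fix_def phi_mult)

lemma dist_one_inv: "x \<in> carrier G \<Longrightarrow> d \<one> (inv x) = d \<one> x"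
  using left_invariant[of \<one> "inv x" x] by (simp add: commute)

lemma dist_inv_mult:
  assumes "x \<in> carrier G" "y \<in> carrier G" "z \<in> carrier G"
  shows "d (inv z \<otimes> x) y = d x (z \<otimes> y)"
  using left_invariant[of "inv z \<otimes> x" y z] assms by (simp add: m_assoc[symmetric])

lemma discrete_geodesic_translate:
  assumes "discrete_geodesic u m" "z \<in> carrier G"
  shows "discrete_geodesic (\<lambda>i. z \<otimes> u i) m"
  using assms by (auto simp: discrete_geodesic_def left_invariant)

text \<open>Left translation by a fixed element is an isometry commuting with \<phi>, so it carries
  flow lines to flow lines.\<close>

lemma heads_translate:
  assumes u: "discrete_geodesic u m" and k: "k \<in> K" and i: "i \<le> m"
  shows "heads \<phi> C (\<lambda>i. k \<otimes> u i) m i \<longleftrightarrow> heads \<phi> C u m i"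
proof -
  have "u i \<in> carrier G" "u m \<in> carrier G" using discrete_geodesic_in[OF u] i by auto
  then show ?thesis
    using k map_in by (simp add: heads_def gprod_def phi_Fix_mult left_invariant Fix_carrier)
qed

text \<open>There are only finitely many displacements \<open>inv x \<otimes> \<phi> x\<close> of
  length at most \<open>D\<close>. Two points \<open>x\<close> and \<open>y\<close> with the same
  displacement satisfy \<open>x \<otimes> inv y \<in> K\<close>, so one representative for each
  value suffices.\<close>

lemma small_displacement_near_Fix:
  obtains \<rho> :: nat where
    "\<And>x. x \<in> carrier G \<Longrightarrow> d x (\<phi> x) \<le> D \<Longrightarrow> \<exists>k\<in>K. d x k \<le> real \<rho>"
proof -
  define B where "B = {g \<in> carrier G. d \<one> g \<le> D}"
  \<comment> \<open>If \<open>g\<close> is not a displacement, \<open>w g\<close> is arbitrary; it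
    can only enlarge the maximum \<open>r\<close>.\<close>
  define w where "w g = (SOME x. x \<in> carrier G \<and> inv x \<otimes> \<phi> x = g)" for g
  define r where "r = Max (insert 0 ((\<lambda>g. d \<one> (w g)) ` B))"
  have fin: "finite (insert 0 ((\<lambda>g. d \<one> (w g)) ` B))"
    unfolding B_def using finite_balls by auto
  have "\<exists>k\<in>K. d x k \<le> real (nat \<lceil>r\<rceil>)" if x: "x \<in> carrier G" "d x (\<phi> x) \<le> D" for x
  proof -
    define g where "g = inv x \<otimes> \<phi> x"
    have gB: "g \<in> B"
      using x map_in left_invariant[of x "\<phi> x" "inv x"] unfolding B_def g_def by simp
    have "\<exists>y. y \<in> carrier G \<and> inv y \<otimes> \<phi> y = g" using x g_def by blast
    from someI_ex[OF this] have w: "w g \<in> carrier G" "inv (w g) \<otimes> \<phi> (w g) = g"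
      unfolding w_def by auto
    have g: "g \<in> carrier G" using gB by (simp add: B_def)
    have px: "\<phi> x = x \<otimes> g" using x map_in by (simp add: g_def m_assoc[symmetric])
    have "w g \<otimes> (inv (w g) \<otimes> \<phi> (w g)) = \<phi> (w g)" using w(1) map_in by (simp add: m_assoc[symmetric])
    then have pw: "\<phi> (w g) = w g \<otimes> g" using w(2) by simp
    have "\<phi> (inv (w g)) = inv (w g \<otimes> g)"
      using group_hom.hom_inv[OF group_hom_phi w(1)] pw by simp
    then have "\<phi> (x \<otimes> inv (w g)) = (x \<otimes> g) \<otimes> (inv g \<otimes> inv (w g))"
      using x w g px by (simp add: phi_mult inv_mult_group)
    also have "\<dots> = x \<otimes> inv (w g)" using x w g
      by (metis inv_closed inv_solve_right m_assoc m_closed)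
    finally have "x \<otimes> inv (w g) \<in> K" using x w by (simp add: Fix_def)
    moreover have "d x (x \<otimes> inv (w g)) = d \<one> (w g)"
      using left_invariant[of \<one> "inv (w g)" x] x w by (simp add: dist_one_inv)
    moreover have "d \<one> (w g) \<le> r" unfolding r_def using fin gB by (intro Max_ge) auto
    ultimately show ?thesis by (intro bexI[of _ "x \<otimes> inv (w g)"]) linarith+
  qed
  then show ?thesis by (rule that)
qed

section \<open>Indecomposable fixed elements\<close>

definition indecomposable :: "'a \<Rightarrow> bool" where
  "indecomposable k \<longleftrightarrow> k \<in> K \<and> k \<notin> generate G {l \<in> K. d \<one> l < d \<one> k}"

text \<open>Otherwise \<open>k\<close> would be the product of \<open>l\<close> and
  \<open>inv l \<otimes> k\<close>, both shorter than \<open>k\<close>. This keeps \<open>K\<close>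
  away from the middle of a geodesic from the identity to \<open>k\<close>.\<close>

lemma indecomposable_not_between:
  assumes "indecomposable k" "l \<in> K" "d \<one> l < d \<one> k"
  shows "d \<one> k \<le> d l k"
proof (rule ccontr)
  assume "\<not> d \<one> k \<le> d l k"
  moreover have kl: "k \<in> carrier G" "l \<in> carrier G" "k \<in> K"
    using assms by (auto simp: indecomposable_def Fix_carrier)
  then have "d \<one> (inv l \<otimes> k) = d l k"
    using left_invariant[of l k "inv l"] by simp
  ultimately have "inv l \<otimes> k \<in> {l \<in> K. d \<one> l < d \<one> k}"
    using assms kl Fix_mult Fix_inv by simp
  then have "l \<otimes> (inv l \<otimes> k) \<in> generate G {l \<in> K. d \<one> l < d \<one> k}"
    using assms by (intro generate.eng generate.incl) auto
  moreover have "l \<otimes> (inv l \<otimes> k) = k" using kl by (simp add: m_assoc[symmetric])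
  ultimately show False using assms by (simp add: indecomposable_def)
qed

lemma indecomposable_inv:
  assumes "indecomposable k" shows "indecomposable (inv k)"
proof -
  have k: "k \<in> K" "k \<in> carrier G" using assms by (auto simp: indecomposable_def Fix_carrier)
  have "inv (inv k) \<in> generate G {l \<in> K. d \<one> l < d \<one> k}"
    if "inv k \<in> generate G {l \<in> K. d \<one> l < d \<one> k}"
    by (rule generate_m_inv_closed) (use that Fix_carrier in auto)
  then show ?thesis
    using assms k by (auto simp: indecomposable_def dist_one_inv Fix_inv)
qed

lemma dist_nat:
  assumes "x \<in> carrier G" "y \<in> carrier G"
  obtains n :: nat where "d x y = real n"
proof -
  obtain u m where "discrete_geodesic u m" "u 0 = x" "u m = y" using geodesics assms by blast
  then show ?thesis using that[of m] discrete_geodesic_dist[of u m 0 m] by auto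
qed

text \<open>Strong induction on the length, which is a natural number: a decomposable element is
  generated by shorter fixed elements.\<close>

lemma finitely_generated_if_finite_indecomposables:
  assumes "finite {k. indecomposable k}"
  shows "finitely_generated_subgroup G K"
proof -
  let ?S = "{k. indecomposable k}"
  have SK: "?S \<subseteq> K" by (auto simp: indecomposable_def)
  have "k \<in> generate G ?S" if "k \<in> K" "d \<one> k = real n" for k n
    using that
  proof (induction n arbitrary: k rule: less_induct)
    case (less n)
    show ?case
    proof (cases "indecomposable k")
      case True
      then show ?thesis by (auto intro: generate.incl)
    next
      case False
      have "{l \<in> K. d \<one> l < d \<one> k} \<subseteq> generate G ?S"
      proof safe
        fix l assume l: "l \<in> K" "d \<one> l < d \<one> k"
        obtain n' where "d \<one> l = real n'" using dist_nat[of \<one> l] l Fix_carrier by auto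
        then show "l \<in> generate G ?S" using less.IH[of n' l] less.prems l by auto
      qed
      moreover have "subgroup (generate G ?S) G"
        using SK Fix_carrier by (intro generate_is_subgroup) auto
      ultimately have "generate G {l \<in> K. d \<one> l < d \<one> k} \<subseteq> generate G ?S"
        by (rule generate_subgroup_incl)
      then show ?thesis using False less.prems by (auto simp: indecomposable_def)
    qed
  qed
  then have "K \<subseteq> generate G ?S" using dist_nat Fix_carrier by (metis one_closed subsetI)
  moreover have "generate G ?S \<subseteq> K" by (rule generate_subgroup_incl[OF SK subgroup_Fix])
  ultimately show ?thesis
    unfolding finitely_generated_subgroup_def using assms subgroup_Fix SK by blast
qed

text \<open>All geodesics \<open>U n\<close> follow one flow line and all \<open>V n\<close> another one; the translate of the
  second line by \<open>k n\<close> merges into the first line at the sink \<open>U n (i n) = k n \<otimes> V n (j n)\<close> and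
  stays close to it afterwards. Hence too many translates of \<open>V l\<close> meet near one point of \<open>U l\<close>.\<close>

lemma no_coherent_sequence:
  fixes U V :: "nat \<Rightarrow> nat \<Rightarrow> 'a" and k :: "nat \<Rightarrow> 'a" and len i j :: "nat \<Rightarrow> nat"
  assumes indec: "\<And>n. indecomposable (k n)"
    and U: "\<And>n. discrete_geodesic (U n) (len n)" and V: "\<And>n. discrete_geodesic (V n) (len n)"
    and U0: "\<And>n. U n 0 = \<one>" and V0: "\<And>n. V n 0 = \<one>"
    and UV: "\<And>n t. t \<le> len n \<Longrightarrow> U n t = k n \<otimes> V n (len n - t)"
    and germ: "\<And>n n'. U n R = U n' R" "\<And>n n'. V n R = V n' R"
    and ij: "\<And>n. i n + j n = len n" "\<And>n. R \<le> i n" "\<And>n. R \<le> j n"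
    and hU: "\<And>n t. R \<le> t \<Longrightarrow> t + T < i n \<Longrightarrow> heads \<phi> C (U n) (len n) t"
      "\<And>n t. R \<le> t \<Longrightarrow> t + T' < i n \<Longrightarrow> heads \<phi> C' (U n) (len n) t"
    and hV: "\<And>n t. R \<le> t \<Longrightarrow> t + T < j n \<Longrightarrow> heads \<phi> C (V n) (len n) t"
      "\<And>n t. R \<le> t \<Longrightarrow> t + T' < j n \<Longrightarrow> heads \<phi> C' (V n) (len n) t"
    and C: "1 + 2 * \<delta> + (L + 2) * (4 * \<delta>) \<le> C"
      "1 + 2 * \<delta> + (L + 2) * (3 * (8 * \<delta> + 4 * real T) + 4 * \<delta>) \<le> C'"
    and mono: "incseq i" "incseq j"
    and drift: "\<And>n m. n \<le> m \<Longrightarrow> i m + j n \<le> j m + i n"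
    and growth: "\<And>n m. n < m \<Longrightarrow> 2 * len n < len m"
  shows False
proof -
  define E where "E = 8 * \<delta> + 4 * real T"
  define E' where "E' = 3 * E + 4 * \<delta> + 2 * real T'"
  have kK: "k n \<in> K" for n using indec by (simp add: indecomposable_def)
  then have kc: "k n \<in> carrier G" for n by (rule Fix_carrier)
  have Uc: "U n t \<in> carrier G" and Vc: "V n t \<in> carrier G" if "t \<le> len n" for n t
    using discrete_geodesic_in[OF U that] discrete_geodesic_in[OF V that] .
  have dk: "d \<one> (k n) = real (len n)" for n
    using discrete_geodesic_dist[OF U, of 0 "len n" n] UV[of "len n" n] U0 V0 kc by simp
  have imono: "i n \<le> i m" "j n \<le> j m" if "n \<le> m" for n m
    using mono that by (auto simp: incseq_def)
  have ilen: "i n \<le> len m" "j n \<le> len m" if "n \<le> m" for n m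
    using imono[OF that] ij(1)[of m] by auto
  \<comment> \<open>The geodesics share the point at time \<open>R\<close>, so the starting error is
    0 and the smaller threshold \<open>C\<close> suffices. By monotonicity of \<open>i\<close>, the
    later geodesic still heads forward up to \<open>i n\<close>.\<close>
  have near_U: "d (U n (i n)) (U l (i n)) \<le> 4 * \<delta> + 2 * real T" if "n \<le> l" for n l
    using heads_fellow_travel_slack[OF U U, of R "i n - R" n R l 0 C T "i n - R"]
      ij(2)[of n] ilen[of n n] ilen[of n l] imono[OF that] that hU(1) C(1) germ(1)[of n l]
      Uc[of R l] by simp
  have near_V: "d (V n (j n)) (V l (j n)) \<le> 4 * \<delta> + 2 * real T" if "n \<le> l" for n l
    using heads_fellow_travel_slack[OF V V, of R "j n - R" n R l 0 C T "j n - R"]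
      ij(3)[of n] ilen[of n n] ilen[of n l] imono[OF that] that hV(1) C(1) germ(2)[of n l]
      Vc[of R l] by simp
  \<comment> \<open>At its sink, the geodesic with index \<open>n\<close> joins its two flow lines;
    both halves are now replaced by those of the longer geodesics with index
    \<open>l\<close>.\<close>
  have merge: "d (U l (i n)) (k n \<otimes> V l (j n)) \<le> E" if "n \<le> l" for n l
  proof -
    have c: "U l (i n) \<in> carrier G" "U n (i n) \<in> carrier G" "V n (j n) \<in> carrier G"
      "V l (j n) \<in> carrier G" using Uc Vc ilen that by auto
    have "len n - i n = j n" using ij(1)[of n] by simp
    then have "U n (i n) = k n \<otimes> V n (j n)" using UV[of "i n" n] ilen[of n n] by simp
    then have "d (U n (i n)) (k n \<otimes> V l (j n)) \<le> 4 * \<delta> + 2 * real T"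
      using near_V[OF that] left_invariant c kc by simp
    then show ?thesis
      using near_U[OF that] triangle[of "U l (i n)" "U n (i n)" "k n \<otimes> V l (j n)"] c kc
      unfolding E_def by (simp add: commute)
  qed
  \<comment> \<open>From the merging point on, the starting error is \<open>E\<close>, which calls
    for \<open>C'\<close>. The drift assumption ensures that the translate of \<open>V l\<close> has
    not passed \<open>j m\<close> when \<open>U l\<close> reaches \<open>i m\<close>.\<close>
  have travel: "d (U l (i m)) (k n \<otimes> V l (j n + (i m - i n))) \<le> E'" if "n \<le> m" "m \<le> l" for n m l
  proof -
    define v where "v = (\<lambda>t. k n \<otimes> V l t)"
    define N where "N = i m - i n"
    have N: "i n + N = i m" "j n + N \<le> j m" using imono[OF that(1)] drift[OF that(1)] by (auto simp: N_def)
    have v: "discrete_geodesic v (len l)"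
      unfolding v_def by (rule discrete_geodesic_translate[OF V kc])
    have "d (U l (i n + N)) (v (j n + N)) \<le> 3 * E + 4 * \<delta> + 2 * real T'"
    proof (rule heads_fellow_travel_slack[OF U v, where n = N])
      show "i n + N \<le> len l" "j n + N \<le> len l" using N that ilen[of m l] by auto
      show "d (U l (i n)) (v (j n)) \<le> E" using merge[of n l] that by (simp add: v_def)
      show "1 + 2 * \<delta> + (L + 2) * (3 * E + 4 * \<delta>) \<le> C'" using C(2) by (simp add: E_def)
      show "heads \<phi> C' (U l) (len l) (i n + s)" if "s + T' < N" for s
        using hU(2)[of "i n + s" l] that N ij(2)[of n] imono(1)[OF \<open>m \<le> l\<close>] by simp
      show "heads \<phi> C' v (len l) (j n + s)" if "s + T' < N" for s
        using hV(2)[of "j n + s" l] heads_translate[OF V[of l] kK[of n], of "j n + s" C']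
          that N ij(3)[of n] imono(2)[OF \<open>m \<le> l\<close>] ilen(2)[OF \<open>m \<le> l\<close>] unfolding v_def by simp
    qed simp
    then show ?thesis using N by (simp add: v_def E'_def N_def)
  qed
  \<comment> \<open>The point \<open>U l (i m)\<close> is near translates of two points of
    \<open>V l\<close>, so \<kappa> moves \<open>V l j'\<close> close to \<open>V l (j m)\<close>.
    If \<kappa> moved it far ahead, \<kappa> would be closer to the end \<open>inv (k l)\<close> of
    \<open>V l\<close> than the identity is, against indecomposability.\<close>
  have drift_bounded: "real (j m) - real (j n + (i m - i n)) \<le> 2 * E'" if "n \<le> m" "m < l" for n m l
  proof -
    define j' where "j' = j n + (i m - i n)"
    define y where "y = U l (i m)"
    define \<kappa> where "\<kappa> = inv (k m) \<otimes> k n"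
    have j': "j' \<le> j m" using drift[OF that(1)] imono[OF that(1)] by (simp add: j'_def)
    have jl: "j m \<le> len l" using ilen that by simp
    have c: "y \<in> carrier G" "V l (j m) \<in> carrier G" "V l j' \<in> carrier G" "\<kappa> \<in> carrier G"
      using Uc[of "i m" l] Vc[of "j m" l] Vc[of j' l] ilen(1)[of m l] that j' jl kc
      by (auto simp: y_def \<kappa>_def)
    have "d y (k n \<otimes> V l j') \<le> E'" using travel[of n m l] that by (simp add: y_def j'_def)
    moreover have "d y (k m \<otimes> V l (j m)) \<le> E'" using travel[of m m l] that by (simp add: y_def)
    moreover have "d (V l (j m)) (\<kappa> \<otimes> V l j') = d (k m \<otimes> V l (j m)) (k n \<otimes> V l j')"
      using dist_inv_mult[of "k n \<otimes> V l j'" "V l (j m)" "k m"] c kc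
      by (simp add: \<kappa>_def m_assoc commute)
    ultimately have close: "d (V l (j m)) (\<kappa> \<otimes> V l j') \<le> 2 * E'"
      using triangle[of "k m \<otimes> V l (j m)" y "k n \<otimes> V l j'"] c kc by (simp add: commute)
    have Vend: "V l (len l) = inv (k l)"
      using UV[of 0 l] U0 Vc[of "len l" l] kc by (metis diff_zero inv_equality inv_inv le0 le_refl)
    have "d \<kappa> (\<kappa> \<otimes> V l j') = real j'"
      using left_invariant[of \<one> "V l j'" \<kappa>] c V0[of l] discrete_geodesic_dist[OF V, of 0 j' l] j' jl by simp
    moreover have "d (V l (j m)) (inv (k l)) = real (len l) - real (j m)"
      using discrete_geodesic_dist[OF V[of l], of "j m" "len l"] jl Vend by simp
    ultimately have "d \<kappa> (inv (k l)) \<le> real j' + 2 * E' + (real (len l) - real (j m))"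
      using close triangle[of \<kappa> "\<kappa> \<otimes> V l j'" "inv (k l)"]
        triangle[of "\<kappa> \<otimes> V l j'" "V l (j m)" "inv (k l)"] c kc by (simp add: commute)
    moreover have "d \<one> (inv (k l)) \<le> d \<kappa> (inv (k l))"
    proof (rule indecomposable_not_between[OF indecomposable_inv[OF indec]])
      show "\<kappa> \<in> K" unfolding \<kappa>_def using kK by (intro Fix_mult Fix_inv)
      have "d \<one> \<kappa> = d (k m) (k n)"
        using dist_inv_mult[of "k n" \<one> "k m"] kc by (simp add: \<kappa>_def commute)
      also have "\<dots> \<le> real (len m) + real (len n)"
        using triangle[of "k m" \<one> "k n"] kc dk[of m] dk[of n] by (simp add: commute)
      also have "\<dots> < real (len l)"
        using growth[OF that(2)] growth[of n m] that(1) by (cases "n = m") auto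
      finally show "d \<one> \<kappa> < d \<one> (inv (k l))" using dist_one_inv kc dk by simp
    qed
    ultimately show ?thesis using dist_one_inv[OF kc] dk unfolding j'_def by simp
  qed
  define B where "B = {x \<in> carrier G. d \<one> x \<le> 3 * E'}"
  \<comment> \<open>Pigeonhole: the \<open>m + 1\<close> elements
    \<open>inv (k n) \<otimes> y\<close> with \<open>n \<le> m\<close> are distinct and all lie
    within \<open>3 * E'\<close> of \<open>z\<close>, but such a ball has only \<open>m\<close>
    elements.\<close>
  define m where "m = card B"
  define y where "y = U (Suc m) (i m)"
  define z where "z = V (Suc m) (j m)"
  have yz: "y \<in> carrier G" "z \<in> carrier G" using Uc Vc ilen[of m "Suc m"] by (auto simp: y_def z_def)
  define f where "f = (\<lambda>n. inv z \<otimes> (inv (k n) \<otimes> y))"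
  have inj: "inj_on f {..m}"
  proof (rule inj_onI)
    fix n n' assume "f n = f n'"
    then have "inv (k n) \<otimes> y = inv (k n') \<otimes> y"
      using yz kc unfolding f_def by simp
    then have "k n = k n'" using yz kc by (metis inv_closed inv_inv right_cancel)
    then have "len n = len n'" using dk[of n] dk[of n'] by simp
    then show "n = n'" using growth[of n n'] growth[of n' n] by (cases n n' rule: linorder_cases) auto
  qed
  have "f n \<in> B" if "n \<le> m" for n
  proof -
    define j' where "j' = j n + (i m - i n)"
    have j': "j' \<le> j m" using drift[OF that] imono[OF that] by (simp add: j'_def)
    have jl: "j m \<le> len (Suc m)" using ilen by simp
    have w: "V (Suc m) j' \<in> carrier G" using Vc j' jl by simp
    have "d (inv (k n) \<otimes> y) (V (Suc m) j') \<le> E'"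
      using travel[of n m "Suc m"] that dist_inv_mult[OF yz(1) w kc] by (simp add: y_def j'_def)
    moreover have "d (V (Suc m) j') z \<le> 2 * E'"
      using drift_bounded[of n m "Suc m"] that discrete_geodesic_dist[OF V[of "Suc m"], of j' "j m"] j' jl
      unfolding z_def j'_def by simp
    ultimately have "d (inv (k n) \<otimes> y) z \<le> 3 * E'"
      using triangle[of "inv (k n) \<otimes> y" "V (Suc m) j'" z] yz w kc by simp
    then show ?thesis
      using dist_inv_mult[of "inv (k n) \<otimes> y" \<one> z] yz kc by (simp add: f_def B_def commute)
  qed
  then have "card {..m} \<le> card B"
    using card_inj_on_le[OF inj, of B] finite_balls by (auto simp: B_def)
  then show False by (simp add: m_def)
qed

theorem Fix_finitely_generated: "finitely_generated_subgroup G K"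
proof (rule finitely_generated_if_finite_indecomposables, rule ccontr)
  assume infinite: "infinite {k. indecomposable k}"
  \<comment> \<open>The constants are fixed in order: \<open>C\<close> serves starting error 0,
    \<open>T\<close> is the delay for \<open>C\<close>, \<open>C'\<close> serves the merging error,
    which depends on \<open>T\<close>, and \<open>T'\<close> is the delay for \<open>C'\<close>. The
    displacement bound \<open>D\<close> serves both delays.\<close>
  define C where "C = 1 + 2 * \<delta> + (L + 2) * (4 * \<delta>)"
  define T where "T = Suc (nat \<lceil>2 * C + 2 * \<delta>\<rceil>)"
  define C' where "C' = C + (1 + 2 * \<delta> + (L + 2) * (3 * (8 * \<delta> + 4 * real T) + 4 * \<delta>))"
  define T' where "T' = Suc (nat \<lceil>2 * C' + 2 * \<delta>\<rceil>)"
  define D where "D = C' + 2 * \<delta> + L * (2 * real (T + T'))"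
  have L0: "0 \<le> L" and d0: "0 \<le> \<delta>" by (rule lipschitz_nonneg, rule delta_nonneg)
  have C: "\<delta> \<le> C" unfolding C_def using L0 d0 by (simp add: add_increasing2)
  have C': "C \<le> C'" "1 + 2 * \<delta> + (L + 2) * (3 * (8 * \<delta> + 4 * real T) + 4 * \<delta>) \<le> C'"
    unfolding C'_def using C L0 d0 by (auto intro!: add_nonneg_nonneg mult_nonneg_nonneg)
  have T: "2 * C + 2 * \<delta> < real T" and T': "2 * C' + 2 * \<delta> < real T'"
    unfolding T_def T'_def by linarith+
  obtain \<rho> :: nat where \<rho>: "\<And>x. x \<in> carrier G \<Longrightarrow> d x (\<phi> x) \<le> D \<Longrightarrow> \<exists>k\<in>K. d x k \<le> real \<rho>"
    using small_displacement_near_Fix[of D] by blast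
  \<comment> \<open>One more than \<rho>, to make the inequalities against \<open>d \<one> k\<close>
    strict.\<close>
  define R where "R = Suc \<rho>"
  define good where "good k u m s \<longleftrightarrow>
      discrete_geodesic u m \<and> u 0 = \<one> \<and> u m = k \<and> R \<le> s \<and> s + R \<le> m \<and>
      (\<forall>i. R \<le> i \<longrightarrow> i + T < s \<longrightarrow> heads \<phi> C u m i) \<and>
      (\<forall>i. R \<le> i \<longrightarrow> i + (T + T') < s \<longrightarrow> heads \<phi> C' u m i) \<and>
      (\<forall>i. R \<le> i \<longrightarrow> i + T < m - s \<longrightarrow> heads \<phi> C (\<lambda>i. u (m - i)) m i) \<and>
      (\<forall>i. R \<le> i \<longrightarrow> i + (T + T') < m - s \<longrightarrow> heads \<phi> C' (\<lambda>i. u (m - i)) m i)"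
    for k u m s
  \<comment> \<open>Finitely many short elements are discarded so that both ends of length
    \<open>R\<close> fit into the geodesic.\<close>
  define I where "I = {k. indecomposable k \<and> 2 * real R \<le> d \<one> k}"
  have "{k. indecomposable k} \<subseteq> I \<union> {x \<in> carrier G. d \<one> x \<le> 2 * real R}"
    by (auto simp: I_def indecomposable_def Fix_carrier)
  then have infI: "infinite I"
    using infinite finite_balls[of "2 * real R"] by (meson finite_UnI infinite_super)
  have "\<exists>u m s. good k u m s" if "k \<in> I" for k
  proof -
    have k: "indecomposable k" "k \<in> carrier G" "2 * real R \<le> d \<one> k"
      using that by (auto simp: I_def indecomposable_def Fix_carrier)
    obtain u m where u: "discrete_geodesic u m" "u 0 = \<one>" "u m = k"
      using geodesics[of \<one> k] k by auto
    have m: "d \<one> k = real m" using discrete_geodesic_dist[OF u(1), of 0 m] u by simp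
    have far: "D < d (u i) (\<phi> (u i))" if i: "R \<le> i" "i + R \<le> m" for i
    proof (rule ccontr)
      assume "\<not> D < d (u i) (\<phi> (u i))"
      moreover have ui: "u i \<in> carrier G" using discrete_geodesic_in[OF u(1)] i by simp
      ultimately obtain l where l: "l \<in> K" "d (u i) l \<le> real \<rho>" using \<rho>[of "u i"] by auto
      have lc: "l \<in> carrier G" using l(1) by (rule Fix_carrier)
      have "d \<one> (u i) = real i" "d (u i) k = real m - real i"
        using discrete_geodesic_dist[OF u(1), of 0 i] discrete_geodesic_dist[OF u(1), of i m] u i by auto
      then have "d \<one> l < d \<one> k" "d l k < d \<one> k"
        using triangle[of \<one> "u i" l] triangle[of l "u i" k] ui lc k l m i
        by (auto simp: R_def commute)
      then show False using indecomposable_not_between[OF k(1) l(1)] by linarith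
    qed
    have "2 * R \<le> m" using m k by linarith
    then obtain s where "R \<le> s" "s + R \<le> m"
      "\<And>i. R \<le> i \<Longrightarrow> i + T < s \<Longrightarrow> heads \<phi> C u m i"
      "\<And>i. R \<le> i \<Longrightarrow> i + (T + T') < s \<Longrightarrow> heads \<phi> C' u m i"
      "\<And>i. R \<le> i \<Longrightarrow> i + T < m - s \<Longrightarrow> heads \<phi> C (\<lambda>i. u (m - i)) m i"
      "\<And>i. R \<le> i \<Longrightarrow> i + (T + T') < m - s \<Longrightarrow> heads \<phi> C' (\<lambda>i. u (m - i)) m i"
      using sink_exists[OF u(1) C C'(1) T T', of R] far unfolding D_def by blast
    then have "good k u m s" unfolding good_def using u by simp
    then show ?thesis by blast
  qed
  then obtain u m s where good: "\<And>k. k \<in> I \<Longrightarrow> good k (u k) (m k) (s k)" by metis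
  \<comment> \<open>The reversed geodesic is translated to start at the identity; it ends at
    \<open>inv k\<close>.\<close>
  define v where "v k t = inv k \<otimes> u k (m k - t)" for k t
  have kI: "indecomposable k" "k \<in> K" "k \<in> carrier G" if "k \<in> I" for k
    using that by (auto simp: I_def indecomposable_def Fix_carrier)
  have u: "discrete_geodesic (u k) (m k)" "u k 0 = \<one>" "u k (m k) = k" if "k \<in> I" for k
    using good[OF that] by (auto simp: good_def)
  have uc: "u k t \<in> carrier G" if "k \<in> I" "t \<le> m k" for k t
    using discrete_geodesic_in[OF u(1)] that by simp
  have v: "discrete_geodesic (v k) (m k)" "v k 0 = \<one>" if "k \<in> I" for k
    unfolding v_def
    using discrete_geodesic_translate[OF discrete_geodesic_rev[OF u(1)[OF that]], of "inv k"] kI[OF that] u[OF that]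
    by auto
  have uv: "u k t = k \<otimes> v k (m k - t)" if "k \<in> I" "t \<le> m k" for k t
    using kI[OF that(1)] uc[OF that] that unfolding v_def by (simp add: m_assoc[symmetric])
  have vu: "v k t = inv k \<otimes> u k (m k - t)" for k t by (simp add: v_def)
  have sR: "R \<le> s k" "s k + R \<le> m k" if "k \<in> I" for k
    using good[OF that] by (auto simp: good_def)
  have hu: "heads \<phi> C (u k) (m k) t" if "k \<in> I" "R \<le> t" "t + T < s k" for k t
    using good[OF that(1)] that by (auto simp: good_def)
  have hu': "heads \<phi> C' (u k) (m k) t" if "k \<in> I" "R \<le> t" "t + (T + T') < s k" for k t
    using good[OF that(1)] that by (auto simp: good_def)
  have hv: "heads \<phi> C (v k) (m k) t" if "k \<in> I" "R \<le> t" "t + T < m k - s k" for k t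
    unfolding v_def
    using heads_translate[OF discrete_geodesic_rev[OF u(1)[OF that(1)]] Fix_inv[OF kI(2)[OF that(1)]], of t C]
      good[OF that(1)] that by (auto simp: good_def)
  have hv': "heads \<phi> C' (v k) (m k) t" if "k \<in> I" "R \<le> t" "t + (T + T') < m k - s k" for k t
    unfolding v_def
    using heads_translate[OF discrete_geodesic_rev[OF u(1)[OF that(1)]] Fix_inv[OF kI(2)[OF that(1)]], of t C']
      good[OF that(1)] that by (auto simp: good_def)
  \<comment> \<open>Only finitely many pairs of points at time \<open>R\<close> occur, so infinitely
    many \<open>k\<close> share one pair; this makes the flow lines common.\<close>
  define germ where "germ k = (u k R, v k R)" for k
  let ?B = "{x \<in> carrier G. d \<one> x \<le> real R}"
  have "germ k \<in> ?B \<times> ?B" if "k \<in> I" for k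
  proof -
    have "R \<le> m k" using sR[OF that] by simp
    then show ?thesis
      using discrete_geodesic_dist[OF u(1)[OF that], of 0 R] discrete_geodesic_dist[OF v(1)[OF that], of 0 R]
        discrete_geodesic_in[OF u(1)[OF that], of R] discrete_geodesic_in[OF v(1)[OF that], of R]
        u(2)[OF that] v(2)[OF that] by (simp add: germ_def)
  qed
  then have "finite (germ ` I)"
    using finite_balls[of "real R"] by (meson finite_SigmaI finite_subset image_subsetI)
  then obtain k0 where "k0 \<in> I" and inf: "infinite {k \<in> I. germ k = germ k0}"
    using pigeonhole_infinite[OF infI] by blast
  define J where "J = {k \<in> I. germ k = germ k0}"
  have "\<exists>k\<in>J. N < m k" for N
  proof (rule ccontr)
    assume "\<not> (\<exists>k\<in>J. N < m k)"
    moreover have "d \<one> k = real (m k)" if "k \<in> I" for k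
      using discrete_geodesic_dist[OF u(1)[OF that], of 0 "m k"] u(2,3)[OF that] by simp
    ultimately have "J \<subseteq> {x \<in> carrier G. d \<one> x \<le> real N}"
      using kI(3) unfolding J_def by (auto simp: not_less)
    then show False using inf finite_balls[of "real N"] finite_subset unfolding J_def by blast
  qed
  then have "\<exists>\<kappa>. \<forall>n. \<kappa> n \<in> J \<and> 2 * m (\<kappa> n) < m (\<kappa> (Suc n))"
    by (intro dependent_nat_choice) blast+
  then obtain \<kappa> where \<kappa>: "\<And>n. \<kappa> n \<in> J" "\<And>n. 2 * m (\<kappa> n) < m (\<kappa> (Suc n))" by blast
  have mono: "strict_mono (\<lambda>n. m (\<kappa> n))"
  proof (rule strict_monoI_Suc)
    show "m (\<kappa> n) < m (\<kappa> (Suc n))" for n using \<kappa>(2)[of n] by linarith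
  qed
  have grow: "2 * m (\<kappa> n) < m (\<kappa> n')" if "n < n'" for n n'
    using \<kappa>(2)[of n] strict_mono_less_eq[OF mono, of "Suc n" n'] that by simp
  define i where "i n = s (\<kappa> n)" for n
  define j where "j n = m (\<kappa> n) - s (\<kappa> n)" for n
  obtain f1 where f1: "strict_mono f1" "incseq (i \<circ> f1)" using incseq_subseq_nat by blast
  obtain f2 where f2: "strict_mono f2" "incseq ((j \<circ> f1) \<circ> f2)" using incseq_subseq_nat by blast
  \<comment> \<open>The sign of the change of \<open>a\<close> decides which of the two flow lines
    advances faster; it becomes constant on a third subsequence.\<close>
  define a where "a n = int (i n) - int (j n)" for n
  obtain f3 where f3: "strict_mono f3" "monoseq (\<lambda>n. a (f1 (f2 (f3 n))))"
    using seq_monosub[of "\<lambda>n. a (f1 (f2 n))"] by blast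
  define f where "f n = f1 (f2 (f3 n))" for n
  have f: "strict_mono f" unfolding f_def using f1(1) f2(1) f3(1) by (simp add: strict_mono_def)
  have inci: "incseq (\<lambda>n. i (f n))"
    using f1(2) f2(1) f3(1) unfolding incseq_def f_def comp_def
    by (simp add: strict_mono_less_eq)
  have incj: "incseq (\<lambda>n. j (f n))"
    using f2(2) f3(1) unfolding incseq_def f_def comp_def
    by (simp add: strict_mono_less_eq)
  have kJ: "\<kappa> (f n) \<in> I" "germ (\<kappa> (f n)) = germ k0" for n using \<kappa>(1)[of "f n"] by (auto simp: J_def)
  have germs: "u (\<kappa> (f n)) R = u (\<kappa> (f n')) R" "v (\<kappa> (f n)) R = v (\<kappa> (f n')) R" for n n'
    using kJ(2)[of n] kJ(2)[of n'] by (auto simp: germ_def)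
  have ij: "i n + j n = m (\<kappa> n)" "R \<le> i n" "R \<le> j n" if "\<kappa> n \<in> I" for n
    using sR[OF that] by (auto simp: i_def j_def)
  have growf: "2 * m (\<kappa> (f n)) < m (\<kappa> (f n'))" if "n < n'" for n n'
    using grow[of "f n" "f n'"] f that by (simp add: strict_mono_def)
  note hyps = kI kJ u v germs ij growf inci incj C'(2)
  \<comment> \<open>If \<open>a\<close> decreases, the drift assumption holds as it stands. If it
    increases, the roles of the two lines are exchanged by passing from each element to its
    inverse.\<close>
  consider "decseq (\<lambda>n. a (f n))" | "incseq (\<lambda>n. a (f n))"
    using f3(2) by (auto simp: monoseq_iff f_def)
  then show False
  proof cases
    case 1
    show False
    proof (rule no_coherent_sequence[where k = "\<lambda>n. \<kappa> (f n)" and U = "\<lambda>n. u (\<kappa> (f n))"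
          and V = "\<lambda>n. v (\<kappa> (f n))" and len = "\<lambda>n. m (\<kappa> (f n))" and R = R and C = C and C' = C'
          and T = T and T' = "T + T'" and i = "\<lambda>n. i (f n)" and j = "\<lambda>n. j (f n)"])
      show "i (f n') + j (f n) \<le> j (f n') + i (f n)" if "n \<le> n'" for n n'
        using decseqD[OF 1 that] by (simp add: a_def)
      show "u (\<kappa> (f n)) t = \<kappa> (f n) \<otimes> v (\<kappa> (f n)) (m (\<kappa> (f n)) - t)"
        if "t \<le> m (\<kappa> (f n))" for n t using uv[OF kJ(1) that] .
    qed (use hyps hu hu' hv hv' in \<open>auto simp: C_def i_def j_def\<close>)
  next
    case 2
    show False
    proof (rule no_coherent_sequence[where k = "\<lambda>n. inv (\<kappa> (f n))" and V = "\<lambda>n. u (\<kappa> (f n))"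
          and U = "\<lambda>n. v (\<kappa> (f n))" and len = "\<lambda>n. m (\<kappa> (f n))" and R = R and C = C and C' = C'
          and T = T and T' = "T + T'" and j = "\<lambda>n. i (f n)" and i = "\<lambda>n. j (f n)"])
      show "j (f n') + i (f n) \<le> i (f n') + j (f n)" if "n \<le> n'" for n n'
        using incseqD[OF 2 that] by (simp add: a_def)
      show "v (\<kappa> (f n)) t = inv (\<kappa> (f n)) \<otimes> u (\<kappa> (f n)) (m (\<kappa> (f n)) - t)" for n t by (rule vu)
      show "j (f n) + i (f n) = m (\<kappa> (f n))" for n using ij(1)[OF kJ(1), of n] by simp
    qed (use hyps hu hu' hv hv' in \<open>auto simp: C_def i_def j_def intro: indecomposable_inv\<close>)
  qed
qed

end

theorem theorem5p7:
  fixes H :: "('a, 'm) monoid_scheme" and A :: "'a set" and \<phi> :: "'a \<Rightarrow> 'a"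
    and d :: "'a \<Rightarrow> 'a \<Rightarrow> real"
    and Hhat :: "'b set" and dhat :: "'b \<Rightarrow> 'b \<Rightarrow> real" and \<iota> :: "'a \<Rightarrow> 'b"
    and \<phi>hat :: "'b \<Rightarrow> 'b"
  assumes "group H"
    and "finite A" and "A \<subseteq> carrier H" and "generate H A = carrier H"
    and "hyperbolic_wrt H A"
    and "\<phi> \<in> hom H H"
    and "visual_metric H A d"
    and "is_metric_completion (carrier H) d Hhat dhat \<iota>"
    and "continuous_map (Metric_space.mtopology Hhat dhat) (Metric_space.mtopology Hhat dhat) \<phi>hat"
    and "\<forall>h\<in>carrier H. \<phi>hat (\<iota> h) = \<iota> (\<phi> h)"
  shows "finitely_generated_subgroup H (Fix H \<phi>)"
proof -
  interpret generated_group H A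
    by (intro generated_group.intro generated_group_axioms.intro assms(1-4))
  obtain \<delta> where "gromov_hyperbolic (carrier H) wdist \<delta>"
    using hyperbolic_imp_gromov_hyperbolic[OF assms(5)] .
  then interpret gromov_hyperbolic "carrier H" wdist \<delta> .
  obtain L where L: "0 \<le> L"
    "\<And>x y. x \<in> carrier H \<Longrightarrow> y \<in> carrier H \<Longrightarrow> wdist (\<phi> x) (\<phi> y) \<le> L * wdist x y"
    using hom_lipschitz[OF assms(6)] by blast
  \<comment> \<open>The word metric supplies left invariance, finite balls and geodesics, and the
    homomorphism is Lipschitz for it.\<close>
  interpret hyperbolic_endomorphism H wdist \<delta> \<phi> L
    by unfold_locales
      (use L assms(6) wdist_left_invariant finite_wdist_ball geodesic_exists in \<open>auto simp: hom_def\<close>)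
  show ?thesis by (rule Fix_finitely_generated)
qed

end
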